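(* For any symmetric function $F:\{-1,1\}^n\to\{-1,1\}$, there exist universal constants $c_0,c_1>0$ such that \[ c_0\cdot r(F)\log\Big(\frac{n}{r(F)}\Big) \;\ge\; \log wt(F)\;\ge\;\log wt_{1/3}(F)\;\ge\; c_1\cdot r(F). \]
   Context: $F$ symmetric means its value depends only on the number of coordinates equal to $-1$; its predicate $D_F:\{0,\dots,n\}\to\{-1,1\}$ gives the value at inputs with exactly $i$ coordinates equal to $-1$. The quantities $r_0(F), r_1(F)$ are the minimum integers $r_0',r_1'$ with $r_0',r_1'\le n/2$ such that $D_F(i)=D_F(i+2)$ for all integers $i\in[r_0',n-r_1')$, and $r(F)=\max\{r_0,r_1\}$. For $p:\{-1,1\}^n\to\mathbb{R}$ with multilinear expansion $p=\sum_{S\subseteq[n]}c_S\prod_{i\in S}x_i$, $wt(p)=\sum_S|c_S|$ (so $wt(F)$ is the spectral norm $\sum_S|\hat F(S)|$). $wt_{\epsilon}(F)$ is the minimum weight of a real polynomial $p$ with $|p(x)-F(x)|<\epsilon$ for all $x\in\{-1,1\}^n$. Logarithms are base 2.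
   Formalization: The last inequality is asserted only when r(F) > 0 (for r(F) = 0, e.g. F constant, it is false since wt_{1/3}(F) = 2/3); the bound n/2 on r_0', r_1' is rounded up so that r(F) is defined for odd n (e.g. majority); the minimum in wt_{1/3} is read as an infimum. *)

theory Defs
  imports "HOL-Analysis.Analysis"
begin

text \<open>Points of the cube are extensional functions on \<open>{1..n}\<close>, so that the cube is a
  finite set with \<open>2 ^ n\<close> elements. Functions on the cube are HOL functions whose values outside
  the cube are irrelevant.\<close>

definition cube :: "nat \<Rightarrow> (nat \<Rightarrow> real) set" where
  "cube n = {1..n} \<rightarrow>\<^sub>E {-1, 1}"

definition neg_count :: "nat \<Rightarrow> (nat \<Rightarrow> real) \<Rightarrow> nat" where
  "neg_count n x = card {i \<in> {1..n}. x i = -1}"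

definition boolean_function :: "nat \<Rightarrow> ((nat \<Rightarrow> real) \<Rightarrow> real) \<Rightarrow> bool" where
  "boolean_function n F \<longleftrightarrow> (\<forall>x \<in> cube n. F x \<in> {-1, 1})"

definition symmetric_function :: "nat \<Rightarrow> ((nat \<Rightarrow> real) \<Rightarrow> real) \<Rightarrow> bool" where
  "symmetric_function n F \<longleftrightarrow>
     (\<forall>x \<in> cube n. \<forall>y \<in> cube n. neg_count n x = neg_count n y \<longrightarrow> F x = F y)"

definition sym_predicate :: "nat \<Rightarrow> ((nat \<Rightarrow> real) \<Rightarrow> real) \<Rightarrow> nat \<Rightarrow> real" where
  "sym_predicate n F i = (THE v. \<forall>x \<in> cube n. neg_count n x = i \<longrightarrow> F x = v)"

lemma sym_predicate_neg_count:
  assumes "symmetric_function n F" and "x \<in> cube n"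
  shows "sym_predicate n F (neg_count n x) = F x"
  unfolding sym_predicate_def
proof (rule the_equality)
  show "\<forall>y \<in> cube n. neg_count n y = neg_count n x \<longrightarrow> F y = F x"
    using assms unfolding symmetric_function_def by blast
next
  fix v assume "\<forall>y \<in> cube n. neg_count n y = neg_count n x \<longrightarrow> F y = v"
  then show "v = F x" using assms(2) by blast
qed

text \<open>The pairs \<open>(r\<^sub>0', r\<^sub>1')\<close> over which \<open>r\<^sub>0\<close> and \<open>r\<^sub>1\<close> are minimised. The condition
  \<open>i + b < n\<close> is \<open>i < n - b\<close>; the condition \<open>i + 2 \<le> n\<close> keeps the arguments of \<open>D\<close> inside its
  domain \<open>{0..n}\<close>. The bound \<open>n / 2\<close> is rounded up: for odd \<open>n\<close>, if
  \<open>D ((n - 1) / 2) \<noteq> D ((n + 3) / 2)\<close> (for example for majority), no pair of integers bounded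
  by \<open>n / 2\<close> satisfies the condition. Whenever there is such a pair, rounding up
  changes nothing, see \<open>r_value_half\<close>.\<close>

definition admissible_pair :: "nat \<Rightarrow> (nat \<Rightarrow> real) \<Rightarrow> nat \<Rightarrow> nat \<Rightarrow> bool" where
  "admissible_pair n D a b \<longleftrightarrow> int a \<le> \<lceil>real n / 2\<rceil> \<and> int b \<le> \<lceil>real n / 2\<rceil> \<and>
     (\<forall>i. a \<le> i \<and> i + b < n \<and> i + 2 \<le> n \<longrightarrow> D i = D (i + 2))"

definition minimal_pair :: "nat \<Rightarrow> (nat \<Rightarrow> real) \<Rightarrow> nat \<Rightarrow> nat \<Rightarrow> bool" where
  "minimal_pair n D r0 r1 \<longleftrightarrow> admissible_pair n D r0 r1 \<and>
     (\<forall>a b. admissible_pair n D a b \<and> a \<le> r0 \<and> b \<le> r1 \<longrightarrow> a = r0 \<and> b = r1)"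

definition r_value :: "nat \<Rightarrow> ((nat \<Rightarrow> real) \<Rightarrow> real) \<Rightarrow> nat" where
  "r_value n F =
     (THE r. \<exists>r0 r1. minimal_pair n (sym_predicate n F) r0 r1 \<and> r = max r0 r1)"

lemma ceiling_half: "\<lceil>real n / 2\<rceil> = int ((n + 1) div 2)"
proof (cases "even n")
  case True
  then obtain k where "n = 2 * k" by blast
  then show ?thesis by simp
next
  case False
  then obtain k where k: "n = 2 * k + 1" by (blast elim: oddE)
  show ?thesis unfolding k by (intro ceiling_unique) auto
qed

lemma minimal_pair_exists: "\<exists>r0 r1. minimal_pair n D r0 r1"
proof -
  let ?h = "(n + 1) div 2"
  let ?P = "\<lambda>s. \<exists>a b. admissible_pair n D a b \<and> s = a + b"
  have "admissible_pair n D ?h ?h"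
    unfolding admissible_pair_def ceiling_half by auto
  then have "?P (?h + ?h)" by blast
  then have "?P (LEAST s. ?P s)" by (rule LeastI)
  then obtain a b where ab: "admissible_pair n D a b" "(LEAST s. ?P s) = a + b" by blast
  have "minimal_pair n D a b"
    unfolding minimal_pair_def
  proof (intro conjI allI impI ab(1); elim conjE)
    fix a' b' assume p: "admissible_pair n D a' b'" and le: "a' \<le> a" "b' \<le> b"
    have "(LEAST s. ?P s) \<le> a' + b'" by (rule Least_le) (use p in blast)
    with ab(2) le show "a' = a" "b' = b" by linarith+
  qed
  then show ?thesis by blast
qed

lemma admissible_pair_min:
  assumes "admissible_pair n D a b" and "admissible_pair n D a' b'"
  shows "admissible_pair n D (min a a') (min b b') \<or>
         (max a b = (n + 1) div 2 \<and> max a' b' = (n + 1) div 2 \<and> odd n)"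
proof (cases "admissible_pair n D (min a a') (min b b')")
  case False
  define h where "h = (n + 1) div 2"
  have le: "a \<le> h" "b \<le> h" "a' \<le> h" "b' \<le> h"
    using assms unfolding admissible_pair_def ceiling_half h_def by auto
  obtain i where i: "min a a' \<le> i" "i + min b b' < n" "i + 2 \<le> n" "D i \<noteq> D (i + 2)"
    using False le unfolding admissible_pair_def ceiling_half h_def by auto
  have 1: "i < a \<or> n \<le> i + b" "i < a' \<or> n \<le> i + b'"
    using assms i(3,4) unfolding admissible_pair_def by (meson not_le_imp_less)+
  have "n \<le> 2 * h" "2 * h \<le> n + 1" unfolding h_def by auto
  with 1 i(1,2) le have "max a b = h \<and> max a' b' = h \<and> n = 2 * h - 1 \<and> h > 0"
    by (auto simp: min_def max_def split: if_splits)
  moreover from this have "odd n" by (cases h) auto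
  ultimately show ?thesis by (auto simp: h_def)
qed auto

lemma minimal_pair_max_unique:
  assumes "minimal_pair n D a b" and "minimal_pair n D a' b'"
  shows "max a b = max a' b'"
proof -
  have adm: "admissible_pair n D a b" "admissible_pair n D a' b'"
    using assms unfolding minimal_pair_def by auto
  from admissible_pair_min[OF adm] show ?thesis
  proof
    assume m: "admissible_pair n D (min a a') (min b b')"
    have "min a a' = a \<and> min b b' = b"
      using assms(1) m unfolding minimal_pair_def by (meson min.cobounded1)
    moreover have "min a a' = a' \<and> min b b' = b'"
      using assms(2) m unfolding minimal_pair_def by (meson min.cobounded2)
    ultimately show ?thesis by simp
  qed auto
qed

lemma r_value_eq:
  assumes "minimal_pair n (sym_predicate n F) r0 r1"
  shows "r_value n F = max r0 r1"
  unfolding r_value_def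
  by (rule the_equality) (use assms minimal_pair_max_unique in blast)+

lemma r_value_half:
  assumes "admissible_pair n (sym_predicate n F) a b"
    and "real a \<le> real n / 2" and "real b \<le> real n / 2"
  obtains r0 r1 where "r_value n F = max r0 r1"
    and "admissible_pair n (sym_predicate n F) r0 r1"
    and "real r0 \<le> real n / 2" and "real r1 \<le> real n / 2"
    and "\<And>a' b'. admissible_pair n (sym_predicate n F) a' b' \<Longrightarrow>
           real a' \<le> real n / 2 \<Longrightarrow> real b' \<le> real n / 2 \<Longrightarrow> r0 \<le> a' \<and> r1 \<le> b'"
proof -
  let ?D = "sym_predicate n F"
  obtain r0 r1 where m: "minimal_pair n ?D r0 r1" using minimal_pair_exists by blast
  have least: "r0 \<le> a' \<and> r1 \<le> b'"
    if p: "admissible_pair n ?D a' b'" and h: "real a' \<le> real n / 2" "real b' \<le> real n / 2"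
    for a' b'
  proof -
    have "2 * a' \<le> n" "2 * b' \<le> n" using h by linarith+
    then have "\<not> (max a' b' = (n + 1) div 2 \<and> odd n)"
      by (cases "even n") (auto simp: max_def elim!: oddE)
    moreover have "admissible_pair n ?D r0 r1" using m unfolding minimal_pair_def by blast
    ultimately have "admissible_pair n ?D (min r0 a') (min r1 b')"
      using admissible_pair_min[OF _ p] by blast
    then have "min r0 a' = r0 \<and> min r1 b' = r1"
      using m unfolding minimal_pair_def by (meson min.cobounded1)
    then show ?thesis by linarith
  qed
  show thesis
  proof (rule that[OF r_value_eq[OF m]])
    show "admissible_pair n ?D r0 r1" using m unfolding minimal_pair_def by blast
    show "real r0 \<le> real n / 2" "real r1 \<le> real n / 2"
      using least[OF assms] assms(2,3) by linarith+
  qed (rule least)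
qed

definition fourier_coeff :: "nat \<Rightarrow> ((nat \<Rightarrow> real) \<Rightarrow> real) \<Rightarrow> nat set \<Rightarrow> real" where
  "fourier_coeff n p S = (\<Sum>x \<in> cube n. p x * (\<Prod>i \<in> S. x i)) / 2 ^ n"

definition wt :: "nat \<Rightarrow> ((nat \<Rightarrow> real) \<Rightarrow> real) \<Rightarrow> real" where
  "wt n p = (\<Sum>S \<in> Pow {1..n}. \<bar>fourier_coeff n p S\<bar>)"

text \<open>On the cube every real function is a unique multilinear polynomial, whose coefficients
  are given by \<open>fourier_coeff\<close>.\<close>

lemma multilinear_expansion:
  assumes "x \<in> cube n"
  shows "p x = (\<Sum>S \<in> Pow {1..n}. fourier_coeff n p S * (\<Prod>i \<in> S. x i))"
proof -
  have fin: "finite (cube n)" unfolding cube_def by (intro finite_PiE) auto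
  have kernel: "(\<Sum>S \<in> Pow {1..n}. (\<Prod>i \<in> S. y i) * (\<Prod>i \<in> S. x i)) =
      (if y = x then 2 ^ n else 0)" if y: "y \<in> cube n" for y
  proof -
    have "(\<Sum>S \<in> Pow {1..n}. (\<Prod>i \<in> S. y i) * (\<Prod>i \<in> S. x i)) = (\<Prod>i \<in> {1..n}. y i * x i + 1)"
      by (subst prod_add) (auto simp: prod.distrib)
    also have "\<dots> = (if y = x then 2 ^ n else 0)"
    proof (cases "y = x")
      case True
      have "x i * x i + 1 = 2" if "i \<in> {1..n}" for i
      proof -
        have "x i \<in> {-1, 1}" using assms that unfolding cube_def by (rule PiE_mem)
        then show ?thesis by auto
      qed
      then have "(\<Prod>i \<in> {1..n}. x i * x i + 1) = (\<Prod>i \<in> {1..n}. 2)" by (intro prod.cong) auto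
      then show ?thesis using True by simp
    next
      case False
      then obtain i where i: "i \<in> {1..n}" "y i \<noteq> x i"
        using y assms PiE_ext unfolding cube_def by metis
      have "x i \<in> {-1, 1}" "y i \<in> {-1, 1}"
        using assms y i(1) unfolding cube_def by (meson PiE_mem)+
      then have "y i * x i + 1 = 0" using i(2) by auto
      then have "(\<Prod>i \<in> {1..n}. y i * x i + 1) = 0" using i(1) by (intro prod_zero) auto
      then show ?thesis using False by simp
    qed
    finally show ?thesis .
  qed
  have "(\<Sum>S \<in> Pow {1..n}. fourier_coeff n p S * (\<Prod>i \<in> S. x i)) =
      (\<Sum>S \<in> Pow {1..n}. \<Sum>y \<in> cube n. p y / 2 ^ n * ((\<Prod>i \<in> S. y i) * (\<Prod>i \<in> S. x i)))"
    unfolding fourier_coeff_def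
    by (simp add: sum_divide_distrib sum_distrib_left sum_distrib_right mult_ac)
  also have "\<dots> = (\<Sum>y \<in> cube n. p y / 2 ^ n *
      (\<Sum>S \<in> Pow {1..n}. (\<Prod>i \<in> S. y i) * (\<Prod>i \<in> S. x i)))"
    by (subst sum.swap) (simp add: sum_distrib_left)
  also have "\<dots> = (\<Sum>y \<in> cube n. if y = x then p y else 0)"
    by (intro sum.cong refl, subst kernel) auto
  also have "\<dots> = p x" using fin assms by simp
  finally show ?thesis by simp
qed

lemma multilinear_expansion_unique:
  assumes p: "\<And>x. x \<in> cube n \<Longrightarrow> p x = (\<Sum>S \<in> Pow {1..n}. c S * (\<Prod>i \<in> S. x i))"
    and T: "T \<subseteq> {1..n}"
  shows "c T = fourier_coeff n p T"
proof -
  have orth: "(\<Sum>x \<in> cube n. (\<Prod>i \<in> S. x i) * (\<Prod>i \<in> T. x i)) = (if S = T then 2 ^ n else 0)"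
    if S: "S \<subseteq> {1..n}" for S
  proof -
    define g where "g i v = (if i \<in> S then v else 1) * (if i \<in> T then v else (1::real))" for i v
    have eq: "(\<Prod>i \<in> U. x i) = (\<Prod>i \<in> {1..n}. if i \<in> U then x i else 1)"
      if "U \<subseteq> {1..n}" for U and x :: "nat \<Rightarrow> real"
      using that by (simp add: prod.inter_restrict[symmetric] Int_absorb1)
    have "(\<Sum>x \<in> cube n. (\<Prod>i \<in> S. x i) * (\<Prod>i \<in> T. x i)) =
        (\<Sum>x \<in> cube n. \<Prod>i \<in> {1..n}. g i (x i))"
      unfolding g_def prod.distrib by (simp add: eq[OF S] eq[OF T])
    also have "\<dots> = (\<Prod>i \<in> {1..n}. \<Sum>v \<in> {-1, 1}. g i v)"
      unfolding cube_def by (rule prod_sum_PiE[symmetric]) auto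
    also have "\<dots> = (if S = T then 2 ^ n else 0)"
    proof (cases "S = T")
      case True
      then have "(\<Prod>i \<in> {1..n}. \<Sum>v \<in> {-1, 1}. g i v) = (\<Prod>i \<in> {1..n}. 2)"
        by (intro prod.cong) (auto simp: g_def)
      then show ?thesis using True by simp
    next
      case False
      then obtain i where i: "i \<in> {1..n}" "i \<in> S \<longleftrightarrow> i \<notin> T" using S T by blast
      then have "(\<Sum>v \<in> {-1, 1}. g i v) = 0" by (auto simp: g_def)
      then have "(\<Prod>i \<in> {1..n}. \<Sum>v \<in> {-1, 1}. g i v) = 0"
        using i(1) by (intro prod_zero) auto
      then show ?thesis using False by simp
    qed
    finally show ?thesis .
  qed
  have "fourier_coeff n p T =
      (\<Sum>x \<in> cube n. \<Sum>S \<in> Pow {1..n}. c S * ((\<Prod>i \<in> S. x i) * (\<Prod>i \<in> T. x i))) / 2 ^ n"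
    unfolding fourier_coeff_def by (simp add: p sum_distrib_left sum_distrib_right mult_ac)
  also have "\<dots> =
      (\<Sum>S \<in> Pow {1..n}. c S * (\<Sum>x \<in> cube n. (\<Prod>i \<in> S. x i) * (\<Prod>i \<in> T. x i))) / 2 ^ n"
    by (subst sum.swap) (simp add: sum_distrib_left)
  also have "\<dots> = (\<Sum>S \<in> Pow {1..n}. if S = T then c S * 2 ^ n else 0) / 2 ^ n"
    by (intro arg_cong2[where f = "(/)"] sum.cong refl) (simp add: orth)
  also have "\<dots> = c T" using T by (simp add: sum.delta)
  finally show ?thesis by simp
qed

text \<open>Because of the strict inequality the minimum need not be attained; it is read as an
  infimum.\<close>

definition wt_approx :: "nat \<Rightarrow> real \<Rightarrow> ((nat \<Rightarrow> real) \<Rightarrow> real) \<Rightarrow> real" where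
  "wt_approx n \<epsilon> F = Inf {wt n p | p. \<forall>x \<in> cube n. \<bar>p x - F x\<bar> < \<epsilon>}"

end

theory Submission
  imports Defs "HOL-Computational_Algebra.Polynomial"
begin

text \<open>Upper bound: unless fewer than \<open>r\<close> or more than \<open>n - r\<close> coordinates are \<open>-1\<close>, \<open>F\<close> is affine
  in the parity of all variables, hence agrees there with a polynomial of weight at most \<open>1\<close>; every
  exceptional point changes the weight by at most \<open>2\<close>.

  Lower bound: let \<open>D k \<noteq> D (k + 2)\<close>. Pair up \<open>2 * m\<close> of the variables, force the bits of \<open>t \<le> m / 2\<close>
  random pairs to agree and those of all other pairs to differ, and average over the latter. Of a
  monomial that contains exactly one bit of \<open>d\<close> pairs at most a fraction \<open>2 ^ (-d)\<close> survives, while \<open>F\<close>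
  becomes the symmetric function \<open>i \<mapsto> D (2 * i + const)\<close> of \<open>t\<close> bits, which jumps in the middle. Such
  a jump cannot be approximated in degree below a constant times \<open>t\<close>, which is witnessed by
  explicit dual weights, so that a polynomial of weight below \<open>2 ^ (c * t)\<close> fails. The constant lower
  bound needed for small \<open>r\<close> comes from a restriction of \<open>F\<close> to two variables.\<close>

subsection \<open>Points of the cube and dual functionals\<close>

text \<open>Encoding a point by its set of -1 coordinates turns characters into signs of
  intersection sizes. The restriction makes the point extensional, as members of
  \<open>cube n\<close> must be.\<close>

definition point :: "nat \<Rightarrow> nat set \<Rightarrow> nat \<Rightarrow> real" where
  "point n U = (\<lambda>i\<in>{1..n}. if i \<in> U then -1 else 1)"

lemma point_in_cube [simp]: "point n U \<in> cube n"
  unfolding point_def cube_def by auto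

lemma cube_mem:
  assumes "x \<in> cube n" "i \<in> {1..n}"
  shows "x i = -1 \<or> x i = 1"
  using assms unfolding cube_def PiE_def Pi_def by auto

lemma neg_count_point: "U \<subseteq> {1..n} \<Longrightarrow> neg_count n (point n U) = card U"
  unfolding neg_count_def point_def by (rule arg_cong[of _ _ card]) auto

lemma bij_betw_point: "bij_betw (point n) (Pow {1..n}) (cube n)"
proof (rule bij_betwI[where g = "\<lambda>x. {i\<in>{1..n}. x i = -1}"])
  fix x assume x: "x \<in> cube n"
  show "point n {i \<in> {1..n}. x i = - 1} = x"
  proof
    fix i
    show "point n {i \<in> {1..n}. x i = - 1} i = x i"
    proof (cases "i \<in> {1..n}")
      case True
      then show ?thesis using cube_mem[OF x True] by (auto simp: point_def)
    next
      case False
      then have "x i = undefined" using x unfolding cube_def by (intro PiE_arb)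
      then show ?thesis using False by (simp only: point_def restrict_def if_False)
    qed
  qed
next
  fix U assume "U \<in> Pow {1..n}"
  then show "{i\<in>{1..n}. point n U i = -1} = U" by (auto simp: point_def)
qed auto

lemma prod_point:
  assumes "S \<subseteq> {1..n}"
  shows "(\<Prod>i\<in>S. point n U i) = (-1) ^ card (S \<inter> U)"
proof -
  have fin: "finite S" using assms finite_subset by blast
  have "(\<Prod>i\<in>S. point n U i) = (\<Prod>i\<in>S. if i \<in> U then -1 else 1)"
    using assms by (intro prod.cong) (auto simp: point_def)
  also have "\<dots> = (\<Prod>i\<in>S \<inter> U. -1)"
    using fin by (rule prod.inter_restrict[symmetric])
  finally show ?thesis by simp
qed

lemma finite_cube [simp]: "finite (cube n)"
  unfolding cube_def by (intro finite_PiE) auto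

lemma abs_prod_cube:
  assumes "x \<in> cube n" "S \<subseteq> {1..n}"
  shows "\<bar>\<Prod>i\<in>S. x i\<bar> = 1"
proof -
  have "\<bar>x i\<bar> = 1" if "i \<in> S" for i
  proof -
    have "i \<in> {1..n}" using assms(2) that by blast
    with cube_mem[OF assms(1)] show ?thesis by force
  qed
  then show ?thesis by (simp add: abs_prod)
qed

section \<open>Sums and characters over the subsets of a finite set\<close>

lemma sum_Pow_card:
  fixes f :: "nat \<Rightarrow> real"
  assumes "finite T"
  shows "(\<Sum>U\<in>Pow T. f (card U)) = (\<Sum>i\<le>card T. real (card T choose i) * f i)"
proof -
  have "(\<Sum>U\<in>Pow T. f (card U)) =
      (\<Sum>i\<le>card T. \<Sum>U\<in>{U\<in>Pow T. card U = i}. f (card U))"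
    using assms by (intro sum.group[symmetric]) (auto intro: card_mono)
  also have "\<dots> = (\<Sum>i\<le>card T. real (card {U\<in>Pow T. card U = i}) * f i)"
    by (intro sum.cong refl) simp
  also have "\<dots> = (\<Sum>i\<le>card T. real (card T choose i) * f i)"
    using n_subsets[OF assms] by (simp add: Pow_def)
  finally show ?thesis .
qed

text \<open>The sum factors over the elements of \<open>C\<close>, and an element of
  \<open>A\<close> in \<open>C\<close> contributes the factor \<open>-1 + 1\<close>.\<close>

lemma sum_Pow_sign:
  fixes C A :: "'a set"
  assumes "finite C"
  shows "(\<Sum>U\<in>Pow C. (-1) ^ card (A \<inter> U)) = (if A \<inter> C = {} then 2 ^ card C else (0::real))"
proof -
  have s: "(\<Prod>b\<in>U. if b \<in> A then -1 else 1) = (-1::real) ^ card (A \<inter> U)" if "U \<subseteq> C" for U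
  proof -
    have "finite U" using that assms finite_subset by blast
    then show ?thesis by (simp add: prod.inter_restrict[symmetric] Int_commute)
  qed
  have "(\<Sum>U\<in>Pow C. (-1) ^ card (A \<inter> U)) = 
      (\<Sum>U\<in>Pow C. (\<Prod>b\<in>U. if b \<in> A then -1 else 1) * (\<Prod>b\<in>C - U. (1::real)))"
    by (intro sum.cong) (auto simp: s)
  also have "\<dots> = (\<Prod>b\<in>C. (if b \<in> A then -1 else 1) + 1)"
    using assms by (rule prod_add[symmetric])
  also have "\<dots> = (if A \<inter> C = {} then 2 ^ card C else 0)"
  proof (cases "A \<inter> C = {}")
    case True
    then have "(\<Prod>b\<in>C. (if b \<in> A then -1 else 1) + 1) = (\<Prod>b\<in>C. (2::real))"
      by (intro prod.cong) auto
    then show ?thesis using True by simp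
  next
    case False
    then obtain b where "b \<in> C" "b \<in> A" by blast
    then have "(\<Prod>b\<in>C. (if b \<in> A then -1 else 1) + (1::real)) = 0"
      using assms by (intro prod_zero) auto
    then show ?thesis using False by simp
  qed
  finally show ?thesis .
qed

text \<open>Expanding \<open>(-1) ^ card (A \<inter> U) = \<Sum>B\<subseteq>A \<inter> U. (-2) ^ card B\<close> shows that the average of
  the character \<open>A\<close> over the sets \<open>U\<close> of size \<open>i\<close> is a polynomial in \<open>i\<close> of degree at
  most \<open>card A\<close>.\<close>

lemma character_moments:
  fixes w :: "nat \<Rightarrow> real" and T A :: "'a set"
  assumes T: "finite T" "A \<subseteq> T" "card A < d"
    and w: "\<And>b. b < d \<Longrightarrow> (\<Sum>i\<le>card T. w i * real (i choose b)) = 0"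
  shows "(\<Sum>U\<in>Pow T. w (card U) / real (card T choose card U) * (-1) ^ card (A \<inter> U)) = 0"
proof -
  define \<Omega> where "\<Omega> i = w i / real (card T choose i)" for i
  have finA: "finite A" using T finite_subset by blast
  \<comment> \<open>For fixed \<open>B\<close>, the identity \<open>choose_mult\<close> turns the
    sum over the supersets of \<open>B\<close> into the binomial moment of \<open>w\<close> of order
    \<open>card B\<close>, up to a constant factor; it vanishes because
    \<open>card B < d\<close>.\<close>
  have inner: "(\<Sum>U\<in>{U\<in>Pow T. B \<subseteq> U}. \<Omega> (card U)) = 0" if B: "B \<subseteq> A" for B
  proof -
    define b t where "b = card B" and "t = card T"
    have BT: "B \<subseteq> T" "finite B" using B T(2) finA finite_subset by auto
    have bt: "b \<le> t" using BT T(1) unfolding b_def t_def by (simp add: card_mono)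
    have "card B \<le> card A" using B finA by (rule card_mono[rotated])
    then have bd: "b < d" using T(3) b_def by simp
    have "(\<Sum>U\<in>{U\<in>Pow T. B \<subseteq> U}. \<Omega> (card U)) = (\<Sum>V\<in>Pow (T - B). \<Omega> (b + card V))"
    proof (rule sum.reindex_bij_witness[where i = "\<lambda>V. B \<union> V" and j = "\<lambda>U. U - B"])
      fix U assume U: "U \<in> {U\<in>Pow T. B \<subseteq> U}"
      then have "finite U" using T(1) by (auto intro: finite_subset)
      then show "\<Omega> (b + card (U - B)) = \<Omega> (card U)"
        using U BT unfolding b_def by (simp add: card_Diff_subset card_mono)
    next
      fix U assume "U \<in> {U\<in>Pow T. B \<subseteq> U}"
      then show "B \<union> (U - B) = U" "U - B \<in> Pow (T - B)" by blast+
    next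
      fix V assume "V \<in> Pow (T - B)"
      then show "B \<union> V - B = V" "B \<union> V \<in> {U\<in>Pow T. B \<subseteq> U}" using BT(1) by blast+
    qed
    also have "\<dots> = (\<Sum>v\<le>t - b. real (t - b choose v) * \<Omega> (b + v))"
      using sum_Pow_card[of "T - B" "\<lambda>v. \<Omega> (b + v)"] T(1) BT
      by (simp add: card_Diff_subset b_def t_def)
    also have "\<dots> = (\<Sum>v\<le>t - b. w (b + v) * real (b + v choose b) / real (t choose b))"
    proof (rule sum.cong[OF refl])
      fix v assume "v \<in> {..t - b}"
      then have le: "b \<le> b + v" "b + v \<le> t" using bt by auto
      have "real (t choose (b + v)) * real (b + v choose b) =
            real (t choose b) * real (t - b choose v)"
        using arg_cong[OF choose_mult[OF le], of real] by simp
      moreover have "real (t choose (b + v)) \<noteq> 0" "real (t choose b) \<noteq> 0"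
        using le by (auto simp: binomial_eq_0_iff)
      ultimately show "real (t - b choose v) * \<Omega> (b + v) =
          w (b + v) * real (b + v choose b) / real (t choose b)"
        unfolding \<Omega>_def t_def[symmetric] by (simp add: divide_simps) (simp add: mult_ac)
    qed
    also have "\<dots> = (\<Sum>i\<in>{b..t}. w i * real (i choose b) / real (t choose b))"
      by (rule sum.reindex_bij_witness[where i = "\<lambda>i. i - b" and j = "\<lambda>v. b + v"])
        (use bt in auto)
    also have "\<dots> = (\<Sum>i\<le>t. w i * real (i choose b) / real (t choose b))"
      by (intro sum.mono_neutral_left) (auto simp: binomial_eq_0)
    also have "\<dots> = (\<Sum>i\<le>t. w i * real (i choose b)) / real (t choose b)"
      by (simp add: sum_divide_distrib)
    also have "\<dots> = 0" using w[OF bd] by (simp add: t_def)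
    finally show ?thesis .
  qed
  have sgn: "(-1::real) ^ card (A \<inter> U) = (\<Sum>B\<in>Pow A. if B \<subseteq> U then (-2) ^ card B else 0)"
    if "U \<subseteq> T" for U
  proof -
    have fin: "finite (A \<inter> U)" using finA by simp
    have "(-1::real) ^ card (A \<inter> U) = (\<Prod>a\<in>A \<inter> U. -2 + 1)" by simp
    also have "\<dots> = (\<Sum>B\<in>Pow (A \<inter> U). (\<Prod>a\<in>B. -2) * (\<Prod>a\<in>A \<inter> U - B. 1))"
      using fin by (rule prod_add)
    also have "\<dots> = (\<Sum>B\<in>Pow (A \<inter> U). (-2) ^ card B)" by simp
    also have "\<dots> = (\<Sum>B\<in>{B\<in>Pow A. B \<subseteq> U}. (-2) ^ card B)"
      by (rule sum.cong) auto
    also have "\<dots> = (\<Sum>B\<in>Pow A. if B \<subseteq> U then (-2) ^ card B else 0)"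
      using finA by (intro sum.inter_filter) simp
    finally show ?thesis .
  qed
  have "(\<Sum>U\<in>Pow T. \<Omega> (card U) * (-1) ^ card (A \<inter> U)) =
      (\<Sum>U\<in>Pow T. \<Sum>B\<in>Pow A. if B \<subseteq> U then (-2) ^ card B * \<Omega> (card U) else 0)"
    by (intro sum.cong refl) (simp add: sgn sum_distrib_left mult_ac if_distrib cong: if_cong)
  also have "\<dots> = (\<Sum>B\<in>Pow A. \<Sum>U\<in>Pow T. if B \<subseteq> U then (-2) ^ card B * \<Omega> (card U) else 0)"
    by (rule sum.swap)
  also have "\<dots> = (\<Sum>B\<in>Pow A. (-2) ^ card B * (\<Sum>U\<in>{U\<in>Pow T. B \<subseteq> U}. \<Omega> (card U)))"
    using T(1) by (intro sum.cong refl) (subst sum.inter_filter[symmetric], auto simp: sum_distrib_left)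
  also have "\<dots> = 0" using inner by simp
  finally show ?thesis unfolding \<Omega>_def .
qed

text \<open>Duality between the l1 norm of the coefficients and the maximum over characters: expand
  \<open>p\<close> into characters and bound the functional on each of them by
  \<open>B\<close>.\<close>

lemma abs_dual_le:
  assumes X: "\<And>a. a \<in> I \<Longrightarrow> X a \<in> cube n"
    and B: "\<And>S. S \<subseteq> {1..n} \<Longrightarrow> \<bar>\<Sum>a\<in>I. \<psi> a * (\<Prod>i\<in>S. X a i)\<bar> \<le> B"
  shows "\<bar>\<Sum>a\<in>I. \<psi> a * p (X a)\<bar> \<le> B * wt n p"
proof -
  have "(\<Sum>a\<in>I. \<psi> a * p (X a)) =
      (\<Sum>a\<in>I. \<Sum>S\<in>Pow {1..n}. fourier_coeff n p S * (\<psi> a * (\<Prod>i\<in>S. X a i)))"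
  proof (rule sum.cong[OF refl])
    fix a assume "a \<in> I"
    show "\<psi> a * p (X a) = (\<Sum>S\<in>Pow {1..n}. fourier_coeff n p S * (\<psi> a * (\<Prod>i\<in>S. X a i)))"
      unfolding multilinear_expansion[OF X[OF \<open>a \<in> I\<close>], of p]
      by (simp add: sum_distrib_left mult_ac)
  qed
  also have "\<dots> = (\<Sum>S\<in>Pow {1..n}. fourier_coeff n p S * (\<Sum>a\<in>I. \<psi> a * (\<Prod>i\<in>S. X a i)))"
    by (subst sum.swap) (simp add: sum_distrib_left)
  also have "\<bar>\<dots>\<bar> \<le> (\<Sum>S\<in>Pow {1..n}. \<bar>fourier_coeff n p S\<bar> * B)"
    by (rule order_trans[OF sum_abs]) (auto simp: abs_mult intro!: sum_mono mult_left_mono B)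
  also have "\<dots> = B * wt n p" unfolding wt_def by (simp add: sum_distrib_left mult_ac)
  finally show ?thesis .
qed

text \<open>Replacing \<open>D\<close> by \<open>p\<close> costs at most a third of the l1 norm of
  \<open>\<psi>\<close>. Hence a functional that is tiny on all characters but correlates with
  \<open>D\<close> beyond this third forces a large weight.\<close>

lemma dual_bound:
  fixes D :: "nat \<Rightarrow> real"
  assumes p: "\<And>x. x \<in> cube n \<Longrightarrow> \<bar>p x - D (neg_count n x)\<bar> < 1 / 3"
    and V: "\<And>a. a \<in> I \<Longrightarrow> V a \<subseteq> {1..n}"
    and B: "\<And>S. S \<subseteq> {1..n} \<Longrightarrow> \<bar>\<Sum>a\<in>I. \<psi> a * (-1) ^ card (S \<inter> V a)\<bar> \<le> B"
  shows "\<bar>\<Sum>a\<in>I. \<psi> a * D (card (V a))\<bar> - (\<Sum>a\<in>I. \<bar>\<psi> a\<bar>) / 3 \<le> B * wt n p"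
proof -
  have "\<bar>\<Sum>a\<in>I. \<psi> a * p (point n (V a))\<bar> \<le> B * wt n p"
    by (rule abs_dual_le) (use B in \<open>auto simp: prod_point\<close>)
  moreover have "\<bar>(\<Sum>a\<in>I. \<psi> a * D (card (V a))) - (\<Sum>a\<in>I. \<psi> a * p (point n (V a)))\<bar>
      \<le> (\<Sum>a\<in>I. \<bar>\<psi> a\<bar>) / 3"
  proof -
    have "\<bar>(\<Sum>a\<in>I. \<psi> a * D (card (V a))) - (\<Sum>a\<in>I. \<psi> a * p (point n (V a)))\<bar>
        = \<bar>\<Sum>a\<in>I. \<psi> a * (D (card (V a)) - p (point n (V a)))\<bar>"
      by (simp add: sum_subtractf right_diff_distrib)
    also have "\<dots> \<le> (\<Sum>a\<in>I. \<bar>\<psi> a\<bar> * (1 / 3))"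
    proof (rule order_trans[OF sum_abs], rule sum_mono)
      fix a assume a: "a \<in> I"
      have "\<bar>D (card (V a)) - p (point n (V a))\<bar> \<le> 1 / 3"
        using p[OF point_in_cube, of "V a"] by (simp add: neg_count_point[OF V[OF a]] abs_minus_commute)
      then show "\<bar>\<psi> a * (D (card (V a)) - p (point n (V a)))\<bar> \<le> \<bar>\<psi> a\<bar> * (1 / 3)"
        unfolding abs_mult by (rule mult_left_mono) simp
    qed
    finally show ?thesis by (simp add: sum_divide_distrib)
  qed
  ultimately show ?thesis by linarith
qed

text \<open>Fix all bits except \<open>k + 1\<close> and \<open>k + 2\<close>, the first
  \<open>k\<close> to -1 and the others to 1. The values of \<open>D\<close> on the two free bits
  are c, e, e, -c, a function whose four Fourier coefficients all have absolute value 1/2. Used as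
  its own dual it gives \<open>4 - 4 / 3 \<le> 2 * wt n p\<close>.\<close>

lemma wt_ge_two_bits:
  fixes D :: "nat \<Rightarrow> real"
  assumes p: "\<And>x. x \<in> cube n \<Longrightarrow> \<bar>p x - D (neg_count n x)\<bar> < 1 / 3"
    and D: "\<And>i. i \<le> n \<Longrightarrow> D i \<in> {-1, 1}" and k: "k + 2 \<le> n" "D k \<noteq> D (k + 2)"
  shows "4 / 3 \<le> wt n p"
proof -
  define V :: "nat \<Rightarrow> nat set" where
    "V a = (if a = 0 then {1..k} else if a = 1 then {1..k+2} else
            if a = 2 then {1..k+1} else insert (k+2) {1..k})" for a
  \<comment> \<open>Since \<open>D (k + 2) = - D k\<close>, this is
    \<open>D k * D (card (V a))\<close>, the restricted function up to sign.\<close>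
  define \<psi> :: "nat \<Rightarrow> real" where
    "\<psi> a = (if a = 0 then 1 else if a = 1 then -1 else D k * D (k+1))" for a
  have I: "{..<4::nat} = {0, 1, 2, 3}" by auto
  have Dv: "D k \<in> {-1, 1}" "D (k+1) \<in> {-1, 1}" "D (k+2) \<in> {-1, 1}"
    using D k(1) by auto
  have "\<bar>\<Sum>a<4. \<psi> a * D (card (V a))\<bar> - (\<Sum>a<4. \<bar>\<psi> a\<bar>) / 3 \<le> 2 * wt n p"
  proof (rule dual_bound[where D = D, OF p])
    fix S :: "nat set" assume "S \<subseteq> {1..n}"
    define s where "s X = (-1::real) ^ card (S \<inter> X)" for X
    have ins: "s (insert b X) = (if b \<in> S then -1 else 1) * s X"
      if "finite X" "b \<notin> X" for b X using that unfolding s_def by (simp add: Int_insert_right)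
    have i1: "{1..k+1} = insert (k+1) {1..k}" and i2: "{1..k+2} = insert (k+2) (insert (k+1) {1..k})"
      by auto
    have s1: "s {1..k} \<in> {-1, 1}"
      unfolding s_def by (simp add: minus_one_power_iff)
    define e1 e2 :: real where "e1 = (if k + 1 \<in> S then -1 else 1)"
      and "e2 = (if k + 2 \<in> S then -1 else 1)"
    have e: "e1 \<in> {-1, 1}" "e2 \<in> {-1, 1}" unfolding e1_def e2_def by auto
    have s2: "s {1..k+1} = e1 * s {1..k}" "s {1..k+2} = e2 * (e1 * s {1..k})"
      "s (insert (k+2) {1..k}) = e2 * s {1..k}"
      unfolding i1 i2 e1_def e2_def by (simp_all add: ins)
    have "(\<Sum>a<4. \<psi> a * (-1) ^ card (S \<inter> V a)) =
      (\<Sum>a\<in>{0, 1, 2, 3}. \<psi> a * s (V a))" unfolding I s_def ..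
    also have "\<dots> = s {1..k} - s {1..k+2} + D k * D (k+1) * (s {1..k+1} + s (insert (k+2) {1..k}))"
      by (simp add: \<psi>_def V_def distrib_left del: One_nat_def)
    \<comment> \<open>One of the two groups cancels: the first if \<open>e1 = e2\<close>, the second
      otherwise.\<close>
    also have "\<bar>\<dots>\<bar> \<le> 2"
      unfolding s2 using s1 Dv(1,2) e by (elim insertE emptyE) simp_all
    finally show "\<bar>\<Sum>a<4. \<psi> a * (-1) ^ card (S \<inter> V a)\<bar> \<le> 2" .
  next
    fix a :: nat assume "a \<in> {..<4}"
    then show "V a \<subseteq> {1..n}" unfolding V_def using k by auto
  qed
  moreover have "\<bar>\<Sum>a<4. \<psi> a * D (card (V a))\<bar> = 4" "(\<Sum>a<4. \<bar>\<psi> a\<bar>) = 4"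
  proof -
    have c: "card (V 0) = k" "card (V 1) = k + 2" "card (V 2) = k + 1" "card (V 3) = k + 1"
      unfolding V_def by auto
    have "D (k + 2) = - D k" using Dv k by auto
    moreover have "\<psi> 0 = 1" "\<psi> 1 = -1" "\<psi> 2 = D k * D (k+1)" "\<psi> 3 = D k * D (k+1)"
      unfolding \<psi>_def by auto
    ultimately show "\<bar>\<Sum>a<4. \<psi> a * D (card (V a))\<bar> = 4" "(\<Sum>a<4. \<bar>\<psi> a\<bar>) = 4"
      unfolding I using Dv(1,2) by (auto simp: c simp del: One_nat_def)
  qed
  ultimately show ?thesis by simp
qed

subsection \<open>Random pairings\<close>

lemma sum_Pow_split:
  fixes h :: "'a set \<Rightarrow> 'a set \<Rightarrow> real"
  assumes "T \<subseteq> M"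
  shows "(\<Sum>U\<in>Pow M. h (U \<inter> T) (U - T)) = (\<Sum>U\<in>Pow T. \<Sum>U'\<in>Pow (M - T). h U U')"
  unfolding sum.cartesian_product
proof (rule sum.reindex_bij_witness[where i = "\<lambda>(U, U'). U \<union> U'" and j = "\<lambda>U. (U \<inter> T, U - T)"])
  fix q assume "q \<in> Pow T \<times> Pow (M - T)"
  then obtain U U' where q: "q = (U, U')" "U \<subseteq> T" "U' \<subseteq> M - T" by blast
  have "(U \<union> U') \<inter> T = U" "U \<union> U' - T = U'" using q by blast+
  then show "((case q of (U, U') \<Rightarrow> U \<union> U') \<inter> T, (case q of (U, U') \<Rightarrow> U \<union> U') - T) = q"
    using q by simp
  show "(case q of (U, U') \<Rightarrow> U \<union> U') \<in> Pow M" using q assms by auto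
qed auto

text \<open>The division by the binomial gives layer \<open>i\<close> of the subsets of
  \<open>T\<close> the total mass \<open>g i\<close>; the part of \<open>U\<close> outside
  \<open>T\<close> is free, whence the power of 2.\<close>

lemma sum_Pow_weights:
  fixes g :: "nat \<Rightarrow> real"
  assumes M: "finite M" and T: "T \<subseteq> M"
  shows "(\<Sum>U\<in>Pow M. g (card (U \<inter> T)) / real (card T choose card (U \<inter> T))) =
    2 ^ (card M - card T) * (\<Sum>i\<le>card T. g i)"
proof -
  have fin: "finite T" using M T by (rule finite_subset[rotated])
  have "(\<Sum>U\<in>Pow M. g (card (U \<inter> T)) / real (card T choose card (U \<inter> T))) =
      (\<Sum>U\<in>Pow T. \<Sum>U'\<in>Pow (M - T). g (card U) / real (card T choose card U))"
    by (rule sum_Pow_split[OF T])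
  also have "\<dots> = 2 ^ (card M - card T) * (\<Sum>U\<in>Pow T. g (card U) / real (card T choose card U))"
    using M fin T by (simp add: card_Pow card_Diff_subset sum_distrib_left)
  also have "(\<Sum>U\<in>Pow T. g (card U) / real (card T choose card U)) =
      (\<Sum>i\<le>card T. real (card T choose i) * (g i / real (card T choose i)))"
    using fin by (rule sum_Pow_card)
  also have "\<dots> = (\<Sum>i\<le>card T. g i)"
    by (intro sum.cong refl) (simp add: binomial_eq_0_iff)
  finally show ?thesis .
qed

text \<open>The sum is a product of a sum over subsets of \<open>T\<close> and one over subsets of
  \<open>M - T\<close>. The second vanishes if \<open>A\<close> leaves \<open>T\<close>; the first
  vanishes by the moment conditions if \<open>A \<subseteq> T\<close> has fewer than
  \<open>d\<close> elements. In the remaining case the l1 norm is the bound.\<close>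

lemma sum_Pow_character:
  fixes w :: "nat \<Rightarrow> real"
  assumes M: "finite M" and T: "T \<subseteq> M" and A: "A \<subseteq> M"
    and w: "\<And>b. b < d \<Longrightarrow> (\<Sum>i\<le>card T. w i * real (i choose b)) = 0"
  shows "\<bar>\<Sum>U\<in>Pow M. w (card (U \<inter> T)) / real (card T choose card (U \<inter> T)) * (-1) ^ card (A \<inter> U)\<bar>
    \<le> (if A \<subseteq> T \<and> d \<le> card A then 2 ^ (card M - card T) * (\<Sum>i\<le>card T. \<bar>w i\<bar>) else 0)"
    (is "\<bar>?s\<bar> \<le> _")
proof (cases "A \<subseteq> T \<and> d \<le> card A")
  case True
  have "\<bar>?s\<bar> \<le> (\<Sum>U\<in>Pow M. \<bar>w (card (U \<inter> T))\<bar> / real (card T choose card (U \<inter> T)))"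
    by (rule order_trans[OF sum_abs]) (simp add: abs_mult power_abs)
  also have "\<dots> = 2 ^ (card M - card T) * (\<Sum>i\<le>card T. \<bar>w i\<bar>)"
    using sum_Pow_weights[OF M T, of "\<lambda>i. \<bar>w i\<bar>"] .
  finally show ?thesis using True by simp
next
  case False
  have fin: "finite T" using M T by (rule finite_subset[rotated])
  define W where "W = (\<Sum>U\<in>Pow T. w (card U) / real (card T choose card U) * (-1) ^ card (A \<inter> U))"
  define Z :: real where "Z = (\<Sum>U\<in>Pow (M - T). (-1) ^ card (A \<inter> U))"
  have "?s = (\<Sum>U\<in>Pow M. w (card (U \<inter> T)) / real (card T choose card (U \<inter> T)) *
      ((-1) ^ card (A \<inter> (U \<inter> T)) * (-1) ^ card (A \<inter> (U - T))))"
  proof (rule sum.cong[OF refl])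
    fix U assume "U \<in> Pow M"
    then have fU: "finite U" using M by (auto intro: finite_subset)
    have "A \<inter> U = (A \<inter> (U \<inter> T)) \<union> (A \<inter> (U - T))" by blast
    moreover have "(A \<inter> (U \<inter> T)) \<inter> (A \<inter> (U - T)) = {}" by blast
    ultimately have "card (A \<inter> U) = card (A \<inter> (U \<inter> T)) + card (A \<inter> (U - T))"
      using fU by (simp add: card_Un_disjoint)
    then show "w (card (U \<inter> T)) / real (card T choose card (U \<inter> T)) * (-1) ^ card (A \<inter> U) =
      w (card (U \<inter> T)) / real (card T choose card (U \<inter> T)) *
      ((-1) ^ card (A \<inter> (U \<inter> T)) * (-1) ^ card (A \<inter> (U - T)))" by (simp only: power_add)
  qed
  also have "\<dots> = (\<Sum>U\<in>Pow T. \<Sum>U'\<in>Pow (M - T). w (card U) / real (card T choose card U) *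
      ((-1) ^ card (A \<inter> U) * (-1) ^ card (A \<inter> U')))"
    by (rule sum_Pow_split[OF T])
  also have "\<dots> = W * Z"
    unfolding W_def Z_def sum_product by (simp add: mult.assoc)
  also have "\<dots> = 0"
  proof (cases "A \<subseteq> T")
    case True
    then have "card A < d" using False by simp
    with fin True have "W = 0" unfolding W_def by (rule character_moments) (rule w)
    then show ?thesis by simp
  next
    case nsub: False
    have "finite (M - T)" using M by simp
    moreover have "A \<inter> (M - T) \<noteq> {}" using A nsub by blast
    ultimately have "Z = 0" unfolding Z_def by (simp add: sum_Pow_sign)
    then show ?thesis by simp
  qed
  finally show ?thesis using False by simp
qed

text \<open>Each unit of \<open>a\<close> gains a factor 2:
  \<open>k * (N choose k) = N * (N - 1 choose (k - 1))\<close> and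
  \<open>2 * k \<le> N\<close>.\<close>

lemma binomial_minus_le:
  assumes "a \<le> t" "2 * t \<le> m"
  shows "2 ^ a * (m - a choose (t - a)) \<le> (m choose t)"
  using assms
proof (induction a)
  case (Suc a)
  define k N where "k = t - a" and "N = m - a"
  have k: "0 < k" "2 * k \<le> N" using Suc.prems unfolding k_def N_def by auto
  have "k * (2 * (N - 1 choose (k - 1))) \<le> N * (N - 1 choose (k - 1))"
    using mult_le_mono1[OF k(2), of "N - 1 choose (k - 1)"] by (simp only: mult_ac)
  also have "\<dots> = k * (N choose k)" using times_binomial_minus1_eq[OF k(1), of N] by simp
  finally have "2 * (N - 1 choose (k - 1)) \<le> (N choose k)" using k(1) by simp
  then have "2 ^ a * (2 * (N - 1 choose (k - 1))) \<le> 2 ^ a * (N choose k)" by simp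
  also have "\<dots> \<le> (m choose t)" using Suc unfolding k_def N_def by simp
  finally show ?case unfolding k_def N_def by (simp add: mult_ac)
qed auto

text \<open>A random \<open>t\<close>-subset of \<open>M\<close>, at most half as large as
  \<open>M\<close>, contains \<open>A\<close> with probability at most 2^(-card A). Removing
  \<open>A\<close> reduces the count to a binomial coefficient.\<close>

lemma card_supersets_le:
  assumes M: "finite M" "A \<subseteq> M" "2 * t \<le> card M"
  shows "2 ^ card A * card {T \<in> Pow M. card T = t \<and> A \<subseteq> T} \<le> (card M choose t)"
proof (cases "card A \<le> t")
  case True
  have finA: "finite A" using M(1,2) by (rule finite_subset[rotated])
  have "bij_betw (\<lambda>T. T - A) {T \<in> Pow M. card T = t \<and> A \<subseteq> T}
      {T. T \<subseteq> M - A \<and> card T = t - card A}"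
  proof (rule bij_betwI[where g = "\<lambda>T. T \<union> A"])
    show "(\<lambda>T. T - A) \<in> {T \<in> Pow M. card T = t \<and> A \<subseteq> T} \<rightarrow> {T. T \<subseteq> M - A \<and> card T = t - card A}"
      using finA by (auto simp: card_Diff_subset)
    show "(\<lambda>T. T \<union> A) \<in> {T. T \<subseteq> M - A \<and> card T = t - card A} \<rightarrow> {T \<in> Pow M. card T = t \<and> A \<subseteq> T}"
    proof
      fix T assume T: "T \<in> {T. T \<subseteq> M - A \<and> card T = t - card A}"
      then have "finite T" using M(1) by (auto intro: finite_subset)
      moreover have "T \<inter> A = {}" using T by blast
      ultimately show "T \<union> A \<in> {T \<in> Pow M. card T = t \<and> A \<subseteq> T}"
        using T True M(2) finA by (auto simp: card_Un_disjoint)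
    qed
  qed auto
  then have "card {T \<in> Pow M. card T = t \<and> A \<subseteq> T} = (card M - card A choose (t - card A))"
    using n_subsets[of "M - A" "t - card A"] M finA
    by (simp add: bij_betw_same_card card_Diff_subset)
  then show ?thesis using binomial_minus_le[OF True M(3)] by simp
next
  case False
  have "{T \<in> Pow M. card T = t \<and> A \<subseteq> T} = {}"
  proof -
    have "card A \<le> card T" if "T \<subseteq> M" "A \<subseteq> T" for T
      using that M(1) by (meson card_mono finite_subset)
    then show ?thesis using False by auto
  qed
  then show ?thesis by (simp only: card.empty)
qed

section \<open>Sizes and signs of block points, and the averaged dual functional\<close>

lemma sign_eq_prod:
  assumes "finite M" "X \<subseteq> M"
  shows "(-1::real) ^ card X = (\<Prod>b\<in>M. if b \<in> X then -1 else 1)"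
proof -
  have "(\<Prod>b\<in>M. if b \<in> X then -1 else 1) = (\<Prod>b\<in>M \<inter> X. (-1::real))"
    using assms(1) by (rule prod.inter_restrict[symmetric])
  also have "M \<inter> X = X" using assms by blast
  finally show ?thesis by simp
qed

text \<open>The first \<open>2 * m\<close> coordinates form the blocks \<open>{b, m + b}\<close>. The two bits of a block agree
  if \<open>b \<in> T\<close> and differ otherwise; \<open>U\<close> is the set of blocks whose first bit is \<open>-1\<close>.
  Of the remaining coordinates exactly \<open>a\<close> are \<open>-1\<close>.\<close>

definition block_set :: "nat \<Rightarrow> nat \<Rightarrow> nat set \<Rightarrow> nat set \<Rightarrow> nat set" where
  "block_set m a T U = U \<union> (+) m ` {b \<in> {1..m}. b \<in> U \<longleftrightarrow> b \<in> T} \<union> {2 * m + 1..2 * m + a}"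

lemma card_block_set_Int:
  assumes "U \<subseteq> {1..m}"
  shows "card (S \<inter> block_set m a T U) =
    card (S \<inter> U) + card {b \<in> {1..m}. m + b \<in> S \<and> (b \<in> U \<longleftrightarrow> b \<in> T)} +
    card (S \<inter> {2 * m + 1..2 * m + a})"
proof -
  let ?Q = "{b \<in> {1..m}. b \<in> U \<longleftrightarrow> b \<in> T}"
  have fU: "finite U" using assms finite_subset by auto
  have "S \<inter> block_set m a T U = (S \<inter> U \<union> (S \<inter> (+) m ` ?Q)) \<union> (S \<inter> {2 * m + 1..2 * m + a})"
    unfolding block_set_def by blast
  moreover have "(S \<inter> U \<union> (S \<inter> (+) m ` ?Q)) \<inter> (S \<inter> {2 * m + 1..2 * m + a}) = {}"
    using assms by fastforce
  moreover have "(S \<inter> U) \<inter> (S \<inter> (+) m ` ?Q) = {}" using assms by fastforce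
  moreover have "S \<inter> (+) m ` ?Q = (+) m ` {b \<in> {1..m}. m + b \<in> S \<and> (b \<in> U \<longleftrightarrow> b \<in> T)}"
    by blast
  ultimately show ?thesis using fU by (simp add: card_Un_disjoint card_image)
qed

text \<open>A block in \<open>T\<close> contributes 2 or 0 according to \<open>U\<close>, every
  other block exactly 1. So only \<open>card (U \<inter> T)\<close> matters, and it moves the size
  in steps of 2.\<close>

lemma card_block_set:
  assumes U: "U \<subseteq> {1..m}" and T: "T \<subseteq> {1..m}"
  shows "card (block_set m a T U) = 2 * card (U \<inter> T) + (m - card T) + a"
proof -
  have fin: "finite U" "finite T" using U T finite_subset by auto
  have "{b \<in> {1..m}. m + b \<in> UNIV \<and> (b \<in> U \<longleftrightarrow> b \<in> T)} = (U \<inter> T) \<union> ({1..m} - (U \<union> T))"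
    using U T by blast
  also have "card \<dots> = card (U \<inter> T) + card ({1..m} - (U \<union> T))"
    using fin by (intro card_Un_disjoint) auto
  also have "card ({1..m} - (U \<union> T)) = m - card (U \<union> T)"
    using U T fin by (subst card_Diff_subset) auto
  finally have "card (block_set m a T U) = card U + (card (U \<inter> T) + (m - card (U \<union> T))) + a"
    using card_block_set_Int[OF U, of UNIV a T] by simp
  moreover have "card (U \<union> T) + card (U \<inter> T) = card U + card T"
    using card_Un_Int[OF fin] by simp
  moreover have "card (U \<union> T) \<le> m" using card_mono[of "{1..m}" "U \<union> T"] U T by simp
  moreover have "card T \<le> m" using card_mono[of "{1..m}" T] T by simp
  ultimately show ?thesis by arith
qed

text \<open>Compare block by block. The sign depends on \<open>U\<close> only in blocks of which
  \<open>S\<close> contains exactly one bit; inverting the second bit in blocks outside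
  \<open>T\<close> gives a factor independent of \<open>U\<close>.\<close>

lemma sign_block_set:
  assumes U: "U \<subseteq> {1..m}" and T: "T \<subseteq> {1..m}"
  shows "(-1::real) ^ card (S \<inter> block_set m a T U) =
    (-1) ^ card ({b \<in> {1..m}. b \<in> S \<longleftrightarrow> m + b \<notin> S} \<inter> U) *
    ((-1) ^ card {b \<in> {1..m} - T. m + b \<in> S} * (-1) ^ card (S \<inter> {2 * m + 1..2 * m + a}))"
proof -
  let ?M = "{1..m}"
  let ?f = "\<lambda>X b. if b \<in> X then -1 else (1::real)"
  have "(-1::real) ^ card (S \<inter> U) * (-1) ^ card {b \<in> ?M. m + b \<in> S \<and> (b \<in> U \<longleftrightarrow> b \<in> T)} =
     (\<Prod>b\<in>?M. ?f (S \<inter> U) b * ?f {b \<in> ?M. m + b \<in> S \<and> (b \<in> U \<longleftrightarrow> b \<in> T)} b)"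
    using U by (subst (1 2) sign_eq_prod[of ?M]) (auto simp: prod.distrib)
  also have "\<dots> = (\<Prod>b\<in>?M. ?f ({b \<in> ?M. b \<in> S \<longleftrightarrow> m + b \<notin> S} \<inter> U) b *
      ?f {b \<in> ?M - T. m + b \<in> S} b)"
    by (rule prod.cong) auto
  also have "\<dots> = (-1) ^ card ({b \<in> ?M. b \<in> S \<longleftrightarrow> m + b \<notin> S} \<inter> U) *
      (-1) ^ card {b \<in> ?M - T. m + b \<in> S}"
    by (subst (1 2) sign_eq_prod[of ?M]) (auto simp: prod.distrib)
  finally show ?thesis
    by (simp only: card_block_set_Int[OF U] power_add mult.assoc)
qed

text \<open>The weights \<open>w\<close> are lifted to all pairs of a \<open>t\<close>-set
  \<open>T\<close> and a set \<open>U\<close> of blocks. On a character with set \<open>A\<close> of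
  half-contained blocks only the \<open>T\<close> containing \<open>A\<close> survive, and only if
  \<open>d \<le> card A\<close>; these are at most a fraction 2^(-d) of all
  \<open>T\<close>.\<close>

lemma block_bound:
  fixes D w :: "nat \<Rightarrow> real"
  defines "W t \<equiv> \<Sum>i\<le>t. \<bar>w i\<bar>"
  assumes p: "\<And>x. x \<in> cube n \<Longrightarrow> \<bar>p x - D (neg_count n x)\<bar> < 1 / 3"
    and le: "2 * m + a \<le> n" "2 * t \<le> m"
    and w: "\<And>b. b < d \<Longrightarrow> (\<Sum>i\<le>t. w i * real (i choose b)) = 0"
  shows "\<bar>\<Sum>i\<le>t. w i * D (2 * i + (m - t) + a)\<bar> - W t / 3 \<le> W t / 2 ^ d * wt n p"
proof -
  let ?M = "{1..m}"
  define TT where "TT = {T \<in> Pow ?M. card T = t}"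
  define v where "v = (\<lambda>(T :: nat set, U :: nat set).
    w (card (U \<inter> T)) / real (t choose card (U \<inter> T)))"
  define V where "V = (\<lambda>(T, U). block_set m a T U)"
  \<comment> \<open>The factor by which lifting multiplies every sum over layers: the choices of
    \<open>T\<close> times the free bits outside \<open>T\<close>.\<close>
  define N where "N = real (m choose t) * 2 ^ (m - t)"
  have TT: "T \<subseteq> ?M" "card T = t" if "T \<in> TT" for T using that unfolding TT_def by auto
  have finTT: "finite TT" unfolding TT_def by simp
  have cTT: "card TT = (m choose t)" unfolding TT_def using n_subsets[of ?M t] by simp
  have N: "N > 0" unfolding N_def using le(2) by simp
  have W0: "0 \<le> W t" unfolding W_def by (simp add: sum_nonneg)
  have "\<bar>\<Sum>q\<in>TT \<times> Pow ?M. v q * D (card (V q))\<bar> - (\<Sum>q\<in>TT \<times> Pow ?M. \<bar>v q\<bar>) / 3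
      \<le> N * (W t / 2 ^ d) * wt n p"
  proof (rule dual_bound[where D = D, OF p])
    fix q assume "q \<in> TT \<times> Pow ?M"
    then obtain T U where q: "q = (T, U)" "U \<subseteq> ?M" by blast
    show "V q \<subseteq> {1..n}" unfolding V_def q block_set_def using q(2) le(1) by auto
  next
    fix S :: "nat set" assume "S \<subseteq> {1..n}"
    define A where "A = {b \<in> ?M. b \<in> S \<longleftrightarrow> m + b \<notin> S}"
    define s where "s T = (-1::real) ^ card {b \<in> ?M - T. m + b \<in> S} *
      (-1) ^ card (S \<inter> {2 * m + 1..2 * m + a})" for T
    have s1: "\<bar>s T\<bar> = 1" for T unfolding s_def by (simp add: abs_mult power_abs)
    have AM: "A \<subseteq> ?M" unfolding A_def by blast
    have "(\<Sum>q\<in>TT \<times> Pow ?M. v q * (-1) ^ card (S \<inter> V q)) =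
      (\<Sum>T\<in>TT. \<Sum>U\<in>Pow ?M. v (T, U) * (-1) ^ card (S \<inter> V (T, U)))"
      by (simp add: sum.cartesian_product)
    also have "\<dots> = (\<Sum>T\<in>TT. (\<Sum>U\<in>Pow ?M. v (T, U) * (-1) ^ card (A \<inter> U)) * s T)"
    proof (rule sum.cong[OF refl])
      fix T assume T: "T \<in> TT"
      have "(\<Sum>U\<in>Pow ?M. v (T, U) * (-1) ^ card (S \<inter> V (T, U))) =
          (\<Sum>U\<in>Pow ?M. v (T, U) * ((-1) ^ card (A \<inter> U) * s T))"
        unfolding V_def prod.case A_def s_def
        by (intro sum.cong refl arg_cong2[where f = "(*)"] sign_block_set TT(1)[OF T]) auto
      then show "(\<Sum>U\<in>Pow ?M. v (T, U) * (-1) ^ card (S \<inter> V (T, U))) =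
          (\<Sum>U\<in>Pow ?M. v (T, U) * (-1) ^ card (A \<inter> U)) * s T"
        by (simp only: sum_distrib_right mult.assoc)
    qed
    also have "\<bar>\<dots>\<bar> \<le> (\<Sum>T\<in>TT. if A \<subseteq> T \<and> d \<le> card A then 2 ^ (m - t) * W t else 0)"
    proof (rule order_trans[OF sum_abs], rule sum_mono)
      fix T assume T: "T \<in> TT"
      note TM = TT[OF T]
      have cM: "card ?M = m" by simp
      have "\<bar>\<Sum>U\<in>Pow ?M. w (card (U \<inter> T)) / real (card T choose card (U \<inter> T)) * (-1) ^ card (A \<inter> U)\<bar>
        \<le> (if A \<subseteq> T \<and> d \<le> card A then 2 ^ (card ?M - card T) * (\<Sum>i\<le>card T. \<bar>w i\<bar>) else 0)"
        by (rule sum_Pow_character) (use TM AM w in auto)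
      then show "\<bar>(\<Sum>U\<in>Pow ?M. v (T, U) * (-1) ^ card (A \<inter> U)) * s T\<bar>
        \<le> (if A \<subseteq> T \<and> d \<le> card A then 2 ^ (m - t) * W t else 0)"
        unfolding TM(2) cM by (simp only: abs_mult s1 v_def W_def prod.case mult_1_right)
    qed
    also have "\<dots> \<le> N * (W t / 2 ^ d)"
    proof (cases "d \<le> card A")
      case True
      have "(\<Sum>T\<in>TT. if A \<subseteq> T \<and> d \<le> card A then 2 ^ (m - t) * W t else 0) =
          (\<Sum>T\<in>{T\<in>TT. A \<subseteq> T}. 2 ^ (m - t) * W t)"
        using True by (simp only: sum.inter_filter[OF finTT] simp_thms)
      also have "\<dots> = real (card {T\<in>TT. A \<subseteq> T}) * (2 ^ (m - t) * W t)" by simp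
      also have "\<dots> \<le> real (m choose t) / 2 ^ d * (2 ^ (m - t) * W t)"
      proof (rule mult_right_mono)
        have eq: "{T\<in>TT. A \<subseteq> T} = {T \<in> Pow ?M. card T = t \<and> A \<subseteq> T}"
          unfolding TT_def by blast
        have "2 ^ d * card {T\<in>TT. A \<subseteq> T} \<le> 2 ^ card A * card {T\<in>TT. A \<subseteq> T}"
          using True by (intro mult_le_mono1 power_increasing) auto
        also have "\<dots> \<le> (m choose t)"
          unfolding eq using card_supersets_le[of ?M A t] AM le(2) by simp
        finally have "real (2 ^ d * card {T\<in>TT. A \<subseteq> T}) \<le> real (m choose t)"
          by (simp only: of_nat_le_iff)
        then show "real (card {T\<in>TT. A \<subseteq> T}) \<le> real (m choose t) / 2 ^ d"
          by (simp add: field_simps)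
      qed (use W0 in simp)
      finally show ?thesis unfolding N_def by (simp add: mult_ac)
    next
      case False
      then show ?thesis using N W0 by simp
    qed
    finally show "\<bar>\<Sum>q\<in>TT \<times> Pow ?M. v q * (-1) ^ card (S \<inter> V q)\<bar> \<le> N * (W t / 2 ^ d)" .
  qed
  moreover have "(\<Sum>q\<in>TT \<times> Pow ?M. v q * D (card (V q))) =
      N * (\<Sum>i\<le>t. w i * D (2 * i + (m - t) + a))"
  proof -
    have "(\<Sum>q\<in>TT \<times> Pow ?M. v q * D (card (V q))) =
        (\<Sum>T\<in>TT. \<Sum>U\<in>Pow ?M. v (T, U) * D (card (V (T, U))))"
      by (simp add: sum.cartesian_product)
    also have "\<dots> = (\<Sum>T\<in>TT. 2 ^ (m - t) * (\<Sum>i\<le>t. w i * D (2 * i + (m - t) + a)))"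
    proof (rule sum.cong[OF refl])
      fix T assume T: "T \<in> TT"
      note TM = TT[OF T]
      have "(\<Sum>U\<in>Pow ?M. v (T, U) * D (card (V (T, U)))) =
        (\<Sum>U\<in>Pow ?M. w (card (U \<inter> T)) * D (2 * card (U \<inter> T) + (m - t) + a) /
          real (card T choose card (U \<inter> T)))"
        by (rule sum.cong[OF refl])
          (use TM in \<open>simp add: V_def v_def card_block_set\<close>)
      also have "\<dots> = 2 ^ (m - t) * (\<Sum>i\<le>t. w i * D (2 * i + (m - t) + a))"
        using sum_Pow_weights[of ?M T "\<lambda>i. w i * D (2 * i + (m - t) + a)"] TM by simp
      finally show "(\<Sum>U\<in>Pow ?M. v (T, U) * D (card (V (T, U)))) =
        2 ^ (m - t) * (\<Sum>i\<le>t. w i * D (2 * i + (m - t) + a))" .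
    qed
    also have "\<dots> = N * (\<Sum>i\<le>t. w i * D (2 * i + (m - t) + a))"
      unfolding N_def by (simp add: cTT)
    finally show ?thesis .
  qed
  moreover have "(\<Sum>q\<in>TT \<times> Pow ?M. \<bar>v q\<bar>) = N * W t"
  proof -
    have "(\<Sum>q\<in>TT \<times> Pow ?M. \<bar>v q\<bar>) = (\<Sum>T\<in>TT. \<Sum>U\<in>Pow ?M. \<bar>v (T, U)\<bar>)"
      by (simp add: sum.cartesian_product)
    also have "\<dots> = (\<Sum>T\<in>TT. 2 ^ (m - t) * W t)"
    proof (rule sum.cong[OF refl])
      fix T assume T: "T \<in> TT"
      note TM = TT[OF T]
      show "(\<Sum>U\<in>Pow ?M. \<bar>v (T, U)\<bar>) = 2 ^ (m - t) * W t"
        using sum_Pow_weights[of ?M T "\<lambda>i. \<bar>w i\<bar>"] TM by (simp add: v_def W_def)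
    qed
    also have "\<dots> = N * W t" unfolding N_def by (simp add: cTT)
    finally show ?thesis .
  qed
  ultimately have "N * (\<bar>\<Sum>i\<le>t. w i * D (2 * i + (m - t) + a)\<bar> - W t / 3) \<le>
      N * (W t / 2 ^ d * wt n p)"
    using N by (simp add: abs_mult algebra_simps)
  then show ?thesis using N by (simp only: mult_le_cancel_left_pos)
qed

subsection \<open>Dual weights for a jump in the middle\<close>

text \<open>The \<open>N\<close>-th finite difference kills degrees below \<open>N\<close>. In the
  induction, a factor \<open>i\<close> of the polynomial is absorbed into the binomial, which lowers
  \<open>N\<close> and the degree by one and shifts the argument.\<close>

lemma alternating_binomial_sum_poly:
  fixes h :: "real poly"
  assumes "degree h < N"
  shows "(\<Sum>i\<le>N. (-1) ^ i * real (N choose i) * poly h (real i)) = 0"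
  using assms
proof (induction N arbitrary: h)
  case (Suc N)
  obtain c h' where h: "h = pCons c h'" by (cases h)
  have split: "(\<Sum>i\<le>Suc N. (-1) ^ i * real (Suc N choose i) * poly h (real i)) =
     c * (\<Sum>i\<le>Suc N. (-1) ^ i * real (Suc N choose i)) +
     (\<Sum>i\<le>Suc N. (-1) ^ i * (real i * real (Suc N choose i)) * poly h' (real i))"
    unfolding h sum_distrib_left sum.distrib[symmetric]
    by (intro sum.cong refl) (simp add: algebra_simps)
  have zero: "(\<Sum>i\<le>Suc N. (-1) ^ i * real (Suc N choose i)) = 0"
    by (rule choose_alternating_sum) simp
  have "(\<Sum>i\<le>Suc N. (-1) ^ i * (real i * real (Suc N choose i)) * poly h' (real i)) =
    (\<Sum>i\<le>N. (-1) ^ Suc i * (real (Suc i) * real (Suc N choose Suc i)) * poly h' (real (Suc i)))"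
    by (subst sum.atMost_Suc_shift) simp
  also have "\<dots> = (\<Sum>i\<le>N. - real (Suc N) *
      ((-1) ^ i * real (N choose i) * poly (pcompose h' [:1, 1:]) (real i)))"
  proof (rule sum.cong[OF refl])
    fix i
    have "real (Suc i) * real (Suc N choose Suc i) = real (Suc N) * real (N choose i)"
      using arg_cong[OF Suc_times_binomial[of i N], of real] by (simp only: of_nat_mult)
    moreover have "poly (pcompose h' [:1, 1:]) (real i) = poly h' (real (Suc i))"
      by (simp add: poly_pcompose)
    ultimately show "(-1) ^ Suc i * (real (Suc i) * real (Suc N choose Suc i)) * poly h' (real (Suc i)) =
      - real (Suc N) * ((-1) ^ i * real (N choose i) * poly (pcompose h' [:1, 1:]) (real i))"
      by (simp only: power_Suc mult_minus_left mult_minus_right mult_1_left mult_ac)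
  qed
  also have "\<dots> = - real (Suc N) *
      (\<Sum>i\<le>N. (-1) ^ i * real (N choose i) * poly (pcompose h' [:1, 1:]) (real i))"
    by (simp only: sum_distrib_left)
  also have "\<dots> = 0"
  proof (cases "h' = 0")
    case False
    then have "degree (pcompose h' [:1, 1:]) < N" using Suc.prems unfolding h by (simp add: degree_pcompose)
    then show ?thesis by (simp only: Suc.IH mult_zero_right)
  qed simp
  finally show ?case using split zero by simp
qed simp

lemma binomial_as_poly:
  obtains Q :: "real poly"
  where "degree Q \<le> b" "\<And>i. poly Q (real i) = real (i choose b)"
proof
  define Q where "Q = smult (1 / fact b) (\<Prod>j<b. [:- real j, 1:])"
  have "degree (\<Prod>j<b. [:- real j, 1:]) \<le> (\<Sum>j<b. (degree \<circ> (\<lambda>j. [:- real j, 1:])) j)"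
    by (rule degree_prod_sum_le) simp
  then show "degree Q \<le> b" unfolding Q_def by simp
  fix i
  have "real (i choose b) = (real i gchoose b)" by (rule binomial_gbinomial)
  also have "\<dots> = (\<Prod>j<b. real i - real j) / fact b"
    by (simp add: gbinomial_prod_rev atLeast0LessThan)
  also have "\<dots> = poly Q (real i)" unfolding Q_def by (simp add: poly_prod)
  finally show "poly Q (real i) = real (i choose b)" ..
qed

section \<open>Weights on equally spaced nodes\<close>

lemma sum_inverse_squares_le: "(\<Sum>k=1..L. 1 / (real k)\<^sup>2) \<le> 2"
proof -
  \<comment> \<open>Strengthened so that the induction telescopes, using 1/(x+1)^2 <= 1/x -
    1/(x+1).\<close>
  have "(\<Sum>k=1..Suc L. 1 / (real k)\<^sup>2) \<le> 2 - 1 / real (Suc L)" for L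
  proof (induction L)
    case (Suc L)
    define x where "x = real (Suc L)"
    have x: "x > 0" unfolding x_def by simp
    have "1 / (x + 1)\<^sup>2 \<le> 1 / (x * (x + 1))"
      using x by (intro divide_left_mono) (auto simp: power2_eq_square)
    also have "\<dots> = 1 / x - 1 / (x + 1)" using x by (simp add: field_simps)
    finally have "1 / (x + 1)\<^sup>2 \<le> 1 / x - 1 / (x + 1)" .
    moreover have "(\<Sum>k=1..Suc (Suc L). 1 / (real k)\<^sup>2) =
        (\<Sum>k=1..Suc L. 1 / (real k)\<^sup>2) + 1 / (x + 1)\<^sup>2"
      by (simp add: x_def add_ac)
    moreover have "real (Suc (Suc L)) = x + 1" unfolding x_def by simp
    ultimately show ?case using Suc unfolding x_def[symmetric] by (simp only:)
  qed simp
  note * = this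
  show ?thesis
  proof (cases L)
    case (Suc L')
    have "1 / real (Suc L') \<ge> 0" by simp
    then show ?thesis using *[of L'] unfolding Suc by linarith
  qed simp
qed

text \<open>Up to scaling, the coefficients of the divided difference over the nodes x = 7(l - L)
  together with 1 and -1: the equally spaced nodes give alternating binomials, the two extra nodes
  the divisor x^2 - 1. The scaling makes the central weight -1.\<close>

definition node_weight :: "nat \<Rightarrow> nat \<Rightarrow> real" where
  "node_weight L l = (-1) ^ (l + L) * real (2 * L choose l) / real (2 * L choose L) /
     (49 * (real l - real L)\<^sup>2 - 1)"

lemma node_denominator:
  assumes "l \<noteq> L"
  shows "48 * (real l - real L)\<^sup>2 \<le> 49 * (real l - real L)\<^sup>2 - 1" "0 < (real l - real L)\<^sup>2"
proof -
  have "1 \<le> \<bar>real l - real L\<bar>" using assms by linarith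
  then have "1\<^sup>2 \<le> \<bar>real l - real L\<bar>\<^sup>2" by (intro power_mono) auto
  then show "48 * (real l - real L)\<^sup>2 \<le> 49 * (real l - real L)\<^sup>2 - 1" "0 < (real l - real L)\<^sup>2"
    by auto
qed

lemma node_denominator_nonzero: "49 * (real l - real L)\<^sup>2 - 1 \<noteq> 0"
proof (cases "l = L")
  case False
  then show ?thesis using node_denominator[OF False] by linarith
qed simp

lemma node_weight_self: "node_weight L L = -1"
  unfolding node_weight_def by simp

text \<open>Binomial ratios are at most 1 and the divisors at least 48(l - L)^2. Each side of the
  centre thus contributes at most 2/48; the spacing 7 is what makes this small.\<close>

lemma sum_abs_node_weight_le:
  "(\<Sum>l\<in>{..2 * L} - {L}. \<bar>node_weight L l\<bar>) \<le> 1 / 12"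
proof -
  have "(\<Sum>l\<in>{..2 * L} - {L}. \<bar>node_weight L l\<bar>) \<le>
      (\<Sum>l\<in>{..2 * L} - {L}. 1 / 48 * (1 / (real l - real L)\<^sup>2))"
  proof (rule sum_mono)
    fix l assume l: "l \<in> {..2 * L} - {L}"
    then have ne: "l \<noteq> L" by simp
    note den = node_denominator[OF ne]
    have "real (2 * L choose l) \<le> real (2 * L choose L)"
      using binomial_maximum'[of L l] by simp
    then have "real (2 * L choose l) / real (2 * L choose L) \<le> 1"
      by (simp add: divide_le_eq_1)
    moreover have "\<bar>node_weight L l\<bar> = real (2 * L choose l) / real (2 * L choose L) /
        (49 * (real l - real L)\<^sup>2 - 1)"
    proof -
      have "0 < 49 * (real l - real L)\<^sup>2 - 1" using den by linarith
      then show ?thesis unfolding node_weight_def by (simp add: abs_mult power_abs)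
    qed
    moreover have "0 \<le> 49 * (real l - real L)\<^sup>2 - 1" using den by linarith
    ultimately have "\<bar>node_weight L l\<bar> \<le> 1 / (49 * (real l - real L)\<^sup>2 - 1)"
      using divide_right_mono[of "real (2 * L choose l) / real (2 * L choose L)" 1] by simp
    also have "\<dots> \<le> 1 / (48 * (real l - real L)\<^sup>2)"
      using den by (intro divide_left_mono) auto
    finally show "\<bar>node_weight L l\<bar> \<le> 1 / 48 * (1 / (real l - real L)\<^sup>2)" by simp
  qed
  also have "\<dots> = 1 / 48 * (\<Sum>l\<in>{..2 * L} - {L}. 1 / (real l - real L)\<^sup>2)"
    by (rule sum_distrib_left[symmetric])
  also have "(\<Sum>l\<in>{..2 * L} - {L}. 1 / (real l - real L)\<^sup>2) =
      (\<Sum>l\<in>{..<L}. 1 / (real l - real L)\<^sup>2) + (\<Sum>l\<in>{L+1..2*L}. 1 / (real l - real L)\<^sup>2)"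
  proof -
    have "{..2 * L} - {L} = {..<L} \<union> {L+1..2*L}" by auto
    moreover have "{..<L} \<inter> {L+1..2*L} = {}" by auto
    ultimately show ?thesis by (simp only: sum.union_disjoint finite_lessThan finite_atLeastAtMost)
  qed
  also have "(\<Sum>l\<in>{..<L}. 1 / (real l - real L)\<^sup>2) = (\<Sum>k=1..L. 1 / (real k)\<^sup>2)"
  proof (rule sum.reindex_bij_witness[where i = "\<lambda>k. L - k" and j = "\<lambda>l. L - l"])
    fix l assume "l \<in> {..<L}"
    then have "real (L - l) = - (real l - real L)" by (simp add: of_nat_diff)
    then show "1 / (real (L - l))\<^sup>2 = 1 / (real l - real L)\<^sup>2" by (simp only: power2_minus)
  qed auto
  also have "(\<Sum>l\<in>{L+1..2*L}. 1 / (real l - real L)\<^sup>2) = (\<Sum>k=1..L. 1 / (real k)\<^sup>2)"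
    by (rule sum.reindex_bij_witness[where i = "\<lambda>k. L + k" and j = "\<lambda>l. l - L"])
      (auto simp: of_nat_diff)
  finally show ?thesis using sum_inverse_squares_le[of L] by simp
qed

text \<open>Subtract from \<open>q\<close> its linear interpolant at \<open>\<plusminus>1\<close> and divide by \<open>x\<^sup>2 - 1\<close>: the alternating
  binomial sum of the quotient vanishes, and the odd part of the interpolant cancels by symmetry.\<close>

lemma node_weight_orthogonal:
  fixes q :: "real poly"
  assumes L: "1 \<le> L" and q: "degree q \<le> 2 * L + 1"
  shows "(\<Sum>l\<le>2 * L. node_weight L l * poly q (7 * (real l - real L))) =
    (\<Sum>l\<le>2 * L. node_weight L l) / 2 * (poly q 1 + poly q (-1))"
proof -
  define P :: "real poly" where "P = [:-1, 0, 1:]"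
  define h r where "h = q div P" and "r = q mod P"
  have P: "degree P = 2" "P \<noteq> 0" unfolding P_def by auto
  have qhr: "q = h * P + r" unfolding h_def r_def by simp
  have "r = 0 \<or> degree r < 2" using degree_mod_less[OF P(2), of q] P(1) unfolding r_def by simp
  then have degr: "degree r \<le> 1" by auto
  then have "degree (h * P) \<le> 2 * L + 1"
    using degree_diff_le[of q "2 * L + 1" r] q qhr by (simp add: algebra_simps)
  \<comment> \<open>Division by \<open>P\<close> lowers the degree by 2, to at most
    \<open>2 * L - 1\<close>, just below the order \<open>2 * L\<close> of the difference applied to
    \<open>h\<close>.\<close>
  then have degh: "degree h < 2 * L"
    using L P by (cases "h = 0") (auto simp: degree_mult_eq)
  define a b where "a = coeff r 0" and "b = coeff r 1"
  have r: "r = [:a, b:]"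
  proof (rule poly_eqI)
    fix n
    show "coeff r n = coeff [:a, b:] n"
    proof (cases n)
      case (Suc k)
      then show ?thesis using degr coeff_eq_0[of r n] by (cases k) (auto simp: a_def b_def)
    qed (simp add: a_def)
  qed
  have val: "poly q x = poly h x * (x\<^sup>2 - 1) + a + b * x" for x
    by (subst qhr) (simp add: r P_def algebra_simps power2_eq_square)
  define B where "B = real (2 * L choose L)"
  have B: "B > 0" unfolding B_def by simp
  have "(\<Sum>l\<le>2 * L. node_weight L l * poly q (7 * (real l - real L))) =
      (\<Sum>l\<le>2 * L. (-1) ^ L / B * ((-1) ^ l * real (2 * L choose l) *
         poly (pcompose h [:- 7 * real L, 7:]) (real l)) + a * node_weight L l +
         7 * b * (node_weight L l * (real l - real L)))"
  proof (rule sum.cong[OF refl])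
    fix l
    define z where "z = 49 * (real l - real L)\<^sup>2 - 1"
    have z: "z \<noteq> 0" "(7 * (real l - real L))\<^sup>2 - 1 = z"
      unfolding z_def power_mult_distrib using node_denominator_nonzero[of l L] by simp_all
    have "node_weight L l * z = (-1) ^ (l + L) * real (2 * L choose l) / B"
      unfolding node_weight_def B_def z_def[symmetric] using z(1) by simp
    then have nz: "node_weight L l * z = (-1) ^ L / B * ((-1) ^ l * real (2 * L choose l))"
      by (simp add: power_add)
    have pc: "poly (pcompose h [:- 7 * real L, 7:]) (real l) = poly h (7 * (real l - real L))"
      by (simp add: poly_pcompose algebra_simps)
    have "node_weight L l * poly q (7 * (real l - real L)) =
        (node_weight L l * z) * poly h (7 * (real l - real L)) + a * node_weight L l +
         7 * b * (node_weight L l * (real l - real L))"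
      unfolding val z(2) by (simp add: algebra_simps)
    then show "node_weight L l * poly q (7 * (real l - real L)) =
        (-1) ^ L / B * ((-1) ^ l * real (2 * L choose l) *
         poly (pcompose h [:- 7 * real L, 7:]) (real l)) + a * node_weight L l +
         7 * b * (node_weight L l * (real l - real L))"
      unfolding nz pc by (simp only: mult.assoc)
  qed
  also have "\<dots> = (-1) ^ L / B * (\<Sum>l\<le>2 * L. (-1) ^ l * real (2 * L choose l) *
         poly (pcompose h [:- 7 * real L, 7:]) (real l)) + a * (\<Sum>l\<le>2 * L. node_weight L l) +
         7 * b * (\<Sum>l\<le>2 * L. node_weight L l * (real l - real L))"
    by (simp only: sum.distrib sum_distrib_left)
  also have "(\<Sum>l\<le>2 * L. (-1) ^ l * real (2 * L choose l) *
         poly (pcompose h [:- 7 * real L, 7:]) (real l)) = 0"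
    by (rule alternating_binomial_sum_poly) (use degh in \<open>simp add: degree_pcompose\<close>)
  also have "(\<Sum>l\<le>2 * L. node_weight L l * (real l - real L)) = 0"
  proof -
    let ?f = "\<lambda>l. node_weight L l * (real l - real L)"
    have "(\<Sum>l\<le>2 * L. ?f l) = (\<Sum>l\<le>2 * L. - ?f l)"
    proof (rule sum.reindex_bij_witness[where i = "\<lambda>l. 2 * L - l" and j = "\<lambda>l. 2 * L - l"])
      fix l assume "l \<in> {..2 * L}"
      then have l: "l \<le> 2 * L" by simp
      have "even (2 * L - l + L) = even (l + L)" using l by auto
      then have "(-1::real) ^ (2 * L - l + L) = (-1) ^ (l + L)" by (simp only: minus_one_power_iff)
      moreover have d: "real (2 * L - l) - real L = - (real l - real L)"
        using l by (simp add: of_nat_diff)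
      moreover have "(2 * L choose (2 * L - l)) = (2 * L choose l)"
        using binomial_symmetric[OF l] by simp
      ultimately have "node_weight L (2 * L - l) = node_weight L l"
        unfolding node_weight_def by (simp only: power2_minus)
      then show "- ?f (2 * L - l) = ?f l" unfolding d by (simp add: algebra_simps)
    qed auto
    then show ?thesis by (simp add: sum_negf)
  qed
  finally show ?thesis using val[of 1] val[of "-1"] by simp
qed

text \<open>The dual witness against approximation in degree \<open>2 * L + 1\<close> of a jump at \<open>7 * L\<close>, for
  functions of the weight in \<open>{..14 * L + 1}\<close>.\<close>

definition jump_weight :: "nat \<Rightarrow> nat \<Rightarrow> real" where
  "jump_weight L i = (\<Sum>l\<le>2 * L. if i = 7 * l then node_weight L l else 0) -
     (\<Sum>l\<le>2 * L. node_weight L l) / 2 *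
       ((if i = 7 * L + 1 then 1 else 0) + (if i = 7 * L - 1 then 1 else 0))"

lemma sum_jump_weight:
  assumes "1 \<le> L"
  shows "(\<Sum>i\<le>14 * L + 1. jump_weight L i * f i) =
    (\<Sum>l\<le>2 * L. node_weight L l * f (7 * l)) -
    (\<Sum>l\<le>2 * L. node_weight L l) / 2 * (f (7 * L + 1) + f (7 * L - 1))"
proof -
  let ?s = "(\<Sum>l\<le>2 * L. node_weight L l) / 2"
  have "(\<Sum>i\<le>14 * L + 1. jump_weight L i * f i) =
      (\<Sum>i\<le>14 * L + 1. (\<Sum>l\<le>2 * L. if i = 7 * l then node_weight L l * f i else 0) -
        ?s * ((if i = 7 * L + 1 then f i else 0) + (if i = 7 * L - 1 then f i else 0)))"
  proof (rule sum.cong[OF refl])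
    fix i
    have "(\<Sum>l\<le>2 * L. if i = 7 * l then node_weight L l else 0) * f i =
        (\<Sum>l\<le>2 * L. if i = 7 * l then node_weight L l * f i else 0)"
      unfolding sum_distrib_right by (rule sum.cong) auto
    then show "jump_weight L i * f i =
        (\<Sum>l\<le>2 * L. if i = 7 * l then node_weight L l * f i else 0) -
        ?s * ((if i = 7 * L + 1 then f i else 0) + (if i = 7 * L - 1 then f i else 0))"
      unfolding jump_weight_def left_diff_distrib
      by (simp only: mult.assoc distrib_right if_distrib[of "\<lambda>x. x * f i"] mult_1_left mult_zero_left)
  qed
  also have "\<dots> = (\<Sum>i\<le>14 * L + 1. \<Sum>l\<le>2 * L. if i = 7 * l then node_weight L l * f i else 0) -
        ?s * ((\<Sum>i\<le>14 * L + 1. if i = 7 * L + 1 then f i else 0) +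
              (\<Sum>i\<le>14 * L + 1. if i = 7 * L - 1 then f i else 0))"
    by (simp only: sum_subtractf sum_distrib_left[symmetric] sum.distrib)
  also have "(\<Sum>i\<le>14 * L + 1. \<Sum>l\<le>2 * L. if i = 7 * l then node_weight L l * f i else 0) =
      (\<Sum>l\<le>2 * L. \<Sum>i\<le>14 * L + 1. if i = 7 * l then node_weight L l * f i else 0)"
    by (rule sum.swap)
  also have "\<dots> = (\<Sum>l\<le>2 * L. node_weight L l * f (7 * l))"
    by (rule sum.cong[OF refl]) (simp add: sum.delta)
  also have "(\<Sum>i\<le>14 * L + 1. if i = 7 * L + 1 then f i else 0) = f (7 * L + 1)"
    by (simp add: sum.delta)
  also have "(\<Sum>i\<le>14 * L + 1. if i = 7 * L - 1 then f i else 0) = f (7 * L - 1)"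
    by (simp add: sum.delta)
  finally show ?thesis .
qed

lemma sum_node_weight_split:
  "(\<Sum>l\<le>2 * L. node_weight L l * g l) = - g L + (\<Sum>l\<in>{..2 * L} - {L}. node_weight L l * g l)"
  by (subst sum.remove[of _ L]) (auto simp: node_weight_self)

lemma abs_sum_node_weight_le:
  assumes "\<And>l. l \<le> 2 * L \<Longrightarrow> \<bar>g l\<bar> \<le> 1"
  shows "\<bar>\<Sum>l\<in>{..2 * L} - {L}. node_weight L l * g l\<bar> \<le> 1 / 12"
proof -
  have "\<bar>\<Sum>l\<in>{..2 * L} - {L}. node_weight L l * g l\<bar> \<le> (\<Sum>l\<in>{..2 * L} - {L}. \<bar>node_weight L l\<bar> * 1)"
    by (rule order_trans[OF sum_abs]) (auto simp: abs_mult intro!: sum_mono mult_left_mono assms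
      simp del: mult_1_right)
  also have "\<dots> \<le> 1 / 12" using sum_abs_node_weight_le[of L] by simp
  finally show ?thesis .
qed

lemma sum_node_weight_bounds:
  "- 13 / 12 \<le> (\<Sum>l\<le>2 * L. node_weight L l)" "(\<Sum>l\<le>2 * L. node_weight L l) \<le> - 11 / 12"
  using sum_node_weight_split[of L "\<lambda>_. 1"] abs_sum_node_weight_le[of L "\<lambda>_. 1"]
  by (simp_all add: abs_le_iff)

text \<open>The map \<open>i \<mapsto> i choose b\<close> is a polynomial of degree at most
  \<open>b\<close>; recentred at \<open>7 * L\<close>, it is annihilated by the divided
  difference.\<close>

lemma jump_weight_orthogonal:
  assumes L: "1 \<le> L" and b: "b < 2 * L + 2"
  shows "(\<Sum>i\<le>14 * L + 1. jump_weight L i * real (i choose b)) = 0"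
proof -
  obtain Q :: "real poly" where Q: "degree Q \<le> b" "\<And>i. poly Q (real i) = real (i choose b)"
    using binomial_as_poly by blast
  define q where "q = pcompose Q [:7 * real L, 1:]"
  have val: "poly q x = poly Q (7 * real L + x)" for x
    unfolding q_def by (simp add: poly_pcompose algebra_simps)
  have "degree q \<le> 2 * L + 1" unfolding q_def using Q(1) b by (simp add: degree_pcompose)
  note orth = node_weight_orthogonal[OF L this]
  have "poly q (7 * (real l - real L)) = real (7 * l choose b)" for l
    unfolding val by (simp add: Q(2)[symmetric] algebra_simps)
  moreover have "poly q 1 = real (7 * L + 1 choose b)"
    unfolding val by (simp add: Q(2)[symmetric] algebra_simps)
  moreover have "poly q (-1) = real (7 * L - 1 choose b)"
    unfolding val using L by (simp add: Q(2)[symmetric] of_nat_diff)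
  ultimately show ?thesis unfolding sum_jump_weight[OF L] using orth by simp
qed

text \<open>Testing against the signs of the weights: the centre gives 1, the other nodes 1/12, the
  two neighbours of the centre together 13/12.\<close>

lemma sum_abs_jump_weight_le:
  assumes "1 \<le> L"
  shows "(\<Sum>i\<le>14 * L + 1. \<bar>jump_weight L i\<bar>) \<le> 13 / 6"
proof -
  let ?s = "\<Sum>l\<le>2 * L. node_weight L l"
  let ?f = "\<lambda>i. sgn (jump_weight L i)"
  have f: "\<bar>?f i\<bar> \<le> 1" for i by (simp add: sgn_real_def)
  have "(\<Sum>i\<le>14 * L + 1. \<bar>jump_weight L i\<bar>) = (\<Sum>i\<le>14 * L + 1. jump_weight L i * ?f i)"
    by (intro sum.cong refl) (simp add: abs_sgn)
  also have "\<dots> = - ?f (7 * L) + (\<Sum>l\<in>{..2 * L} - {L}. node_weight L l * ?f (7 * l)) -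
      ?s / 2 * (?f (7 * L + 1) + ?f (7 * L - 1))"
    unfolding sum_jump_weight[OF assms] sum_node_weight_split ..
  also have "\<dots> \<le> 1 + 1 / 12 + 13 / 24 * 2"
  proof -
    have "- ?f (7 * L) \<le> 1" using f[of "7 * L"] by linarith
    moreover have "(\<Sum>l\<in>{..2 * L} - {L}. node_weight L l * ?f (7 * l)) \<le> 1 / 12"
      using abs_sum_node_weight_le[of L "\<lambda>l. ?f (7 * l)"] f by (auto simp: abs_le_iff)
    moreover have "(- ?s / 2) * (?f (7 * L + 1) + ?f (7 * L - 1)) \<le> (- ?s / 2) * 2"
    proof (rule mult_left_mono)
      show "?f (7 * L + 1) + ?f (7 * L - 1) \<le> 2"
        using f[of "7 * L + 1"] f[of "7 * L - 1"] by linarith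
      show "0 \<le> - ?s / 2" using sum_node_weight_bounds[of L] by linarith
    qed
    ultimately show ?thesis using sum_node_weight_bounds(1)[of L] by linarith
  qed
  finally show ?thesis by simp
qed

text \<open>The centre and its right neighbour contribute with the same sign. The worst case is a
  left neighbour cancelling the right one, which leaves the centre and an error of at most
  1/12.\<close>

lemma jump_weight_correlation:
  fixes D :: "nat \<Rightarrow> real"
  assumes L: "1 \<le> L" and D: "\<And>i. i \<le> 14 * L + 1 \<Longrightarrow> D i \<in> {-1, 1}"
    and jump: "D (7 * L) \<noteq> D (7 * L + 1)"
  shows "11 / 12 \<le> \<bar>\<Sum>i\<le>14 * L + 1. jump_weight L i * D i\<bar>"
proof -
  let ?s = "\<Sum>l\<le>2 * L. node_weight L l"
  define rest where "rest = (\<Sum>l\<in>{..2 * L} - {L}. node_weight L l * D (7 * l))"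
  have "\<bar>D (7 * l)\<bar> \<le> 1" if "l \<le> 2 * L" for l using D[of "7 * l"] that by auto
  then have rest: "\<bar>rest\<bar> \<le> 1 / 12" unfolding rest_def by (rule abs_sum_node_weight_le)
  have "(\<Sum>i\<le>14 * L + 1. jump_weight L i * D i) =
      - D (7 * L) + rest - ?s / 2 * (D (7 * L + 1) + D (7 * L - 1))"
    unfolding sum_jump_weight[OF L] sum_node_weight_split rest_def ..
  moreover have "D (7 * L) = -1 \<or> D (7 * L) = 1" "D (7 * L - 1) = -1 \<or> D (7 * L - 1) = 1"
    using D[of "7 * L"] D[of "7 * L - 1"] by simp_all
  moreover have "D (7 * L + 1) = - D (7 * L)"
    using D[of "7 * L"] D[of "7 * L + 1"] jump by auto
  ultimately show ?thesis
    using rest sum_node_weight_bounds[of L] by (elim disjE; simp; linarith)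
qed

section \<open>Exponential weight from a jump far from both ends\<close>

lemma wt_nonneg: "0 \<le> wt n p"
  unfolding wt_def by (simp add: sum_nonneg)

lemma wt_ge_exponential:
  fixes D :: "nat \<Rightarrow> real"
  assumes p: "\<And>x. x \<in> cube n \<Longrightarrow> \<bar>p x - D (neg_count n x)\<bar> < 1 / 3"
    and D: "\<And>i. i \<le> n \<Longrightarrow> D i \<in> {-1, 1}" and jump: "D k \<noteq> D (k + 2)"
    and L: "1 \<le> L" and m: "28 * L + 2 \<le> m" "m \<le> k + 1" "m + k + 1 \<le> n"
  shows "4 ^ L / 4 \<le> wt n p"
proof -
  \<comment> \<open>Chosen so that the centre \<open>7 * L\<close> of the jump weights corresponds
    to \<open>k\<close> and its right neighbour to \<open>k + 2\<close>.\<close>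
  define t a where "t = 14 * L + 1" and "a = k + 1 - m"
  define D' where "D' i = D (2 * i + (m - t) + a)" for i
  define W where "W = (\<Sum>i\<le>t. \<bar>jump_weight L i\<bar>)"
  have "\<bar>\<Sum>i\<le>t. jump_weight L i * D' i\<bar> - W / 3 \<le> W / 2 ^ (2 * L + 2) * wt n p"
    unfolding D'_def W_def
  proof (rule block_bound[where D = D, OF p])
    show "2 * m + a \<le> n" "2 * t \<le> m" using m unfolding t_def a_def by auto
    show "(\<Sum>i\<le>t. jump_weight L i * real (i choose b)) = 0" if "b < 2 * L + 2" for b
      unfolding t_def using L that by (rule jump_weight_orthogonal)
  qed
  moreover have "11 / 12 \<le> \<bar>\<Sum>i\<le>t. jump_weight L i * D' i\<bar>"
    unfolding t_def
  proof (rule jump_weight_correlation[OF L])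
    have "2 * (7 * L) + (m - t) + a = k" "2 * (7 * L + 1) + (m - t) + a = k + 2"
      using m unfolding t_def a_def by auto
    then show "D' (7 * L) \<noteq> D' (7 * L + 1)" using jump unfolding D'_def by simp
    show "D' i \<in> {-1, 1}" if "i \<le> 14 * L + 1" for i
      unfolding D'_def using m that by (intro D) (auto simp: t_def a_def)
  qed
  moreover have W: "W \<le> 13 / 6" unfolding W_def t_def by (rule sum_abs_jump_weight_le[OF L])
  \<comment> \<open>The correlation beats a third of the l1 norm: 11/12 - 13/18 = 7/36.\<close>
  ultimately have "7 / 36 \<le> W / 2 ^ (2 * L + 2) * wt n p" by linarith
  also have "\<dots> \<le> 13 / 6 / 2 ^ (2 * L + 2) * wt n p"
    using W wt_nonneg by (intro mult_right_mono divide_right_mono) auto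
  also have "(2::real) ^ (2 * L + 2) = 4 * 4 ^ L" by (simp add: power_add power_mult)
  finally show ?thesis using wt_nonneg[of n p] by (simp add: field_simps)
qed

subsection \<open>The upper bound\<close>

lemma abs_fourier_coeff_le:
  assumes "S \<subseteq> {1..n}"
  shows "\<bar>fourier_coeff n p S\<bar> \<le> (\<Sum>x\<in>cube n. \<bar>p x\<bar>) / 2 ^ n"
proof -
  have "\<bar>\<Sum>x\<in>cube n. p x * (\<Prod>i\<in>S. x i)\<bar> \<le> (\<Sum>x\<in>cube n. \<bar>p x\<bar>)"
    by (rule order_trans[OF sum_abs], rule sum_mono) (simp add: abs_mult abs_prod_cube[OF _ assms])
  then show ?thesis unfolding fourier_coeff_def by (simp add: divide_right_mono)
qed

text \<open>Each of the 2^n coefficients is at most the l1 norm over 2^n. Hence changing one value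
  by at most 2 costs at most 2 in weight.\<close>

lemma wt_le_l1: "wt n p \<le> (\<Sum>x\<in>cube n. \<bar>p x\<bar>)"
proof -
  have "wt n p \<le> (\<Sum>S\<in>Pow {1..n}. (\<Sum>x\<in>cube n. \<bar>p x\<bar>) / 2 ^ n)"
    unfolding wt_def by (rule sum_mono) (simp add: abs_fourier_coeff_le)
  also have "\<dots> = (\<Sum>x\<in>cube n. \<bar>p x\<bar>)" by (simp add: card_Pow)
  finally show ?thesis .
qed

lemma wt_le_wt_plus_l1: "wt n p \<le> wt n q + (\<Sum>x\<in>cube n. \<bar>p x - q x\<bar>)"
proof -
  have "fourier_coeff n p S = fourier_coeff n q S + fourier_coeff n (\<lambda>x. p x - q x) S" for S
    unfolding fourier_coeff_def
    by (simp add: left_diff_distrib sum_subtractf diff_divide_distrib)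
  then have "wt n p \<le> wt n q + wt n (\<lambda>x. p x - q x)"
    unfolding wt_def sum.distrib[symmetric] by (intro sum_mono) simp
  then show ?thesis using wt_le_l1[of n "\<lambda>x. p x - q x"] by linarith
qed

lemma abs_le_wt:
  assumes "x \<in> cube n"
  shows "\<bar>p x\<bar> \<le> wt n p"
proof -
  have "\<bar>p x\<bar> = \<bar>\<Sum>S\<in>Pow {1..n}. fourier_coeff n p S * (\<Prod>i\<in>S. x i)\<bar>"
    by (simp only: multilinear_expansion[OF assms, symmetric])
  also have "\<dots> \<le> wt n p"
    unfolding wt_def
    by (rule order_trans[OF sum_abs], rule sum_mono) (simp add: abs_mult abs_prod_cube[OF assms])
  finally show ?thesis .
qed

lemma wt_affine_parity_le: "wt n (\<lambda>x. A + B * (\<Prod>i\<in>{1..n}. x i)) \<le> \<bar>A\<bar> + \<bar>B\<bar>"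
proof -
  \<comment> \<open>A sum of two conditionals, because \<open>{}\<close> and \<open>{1..n}\<close>
    coincide for \<open>n = 0\<close>.\<close>
  define c where "c S = (if S = {} then A else 0) + (if S = {1..n} then B else 0)" for S :: "nat set"
  have "c S = fourier_coeff n (\<lambda>x. A + B * (\<Prod>i\<in>{1..n}. x i)) S" if "S \<subseteq> {1..n}" for S
  proof (rule multilinear_expansion_unique[OF _ that])
    fix x
    have "(\<Sum>S\<in>Pow {1..n}. c S * (\<Prod>i\<in>S. x i)) =
      (\<Sum>S\<in>Pow {1..n}. (if S = {} then A * (\<Prod>i\<in>S. x i) else 0) +
         (if S = {1..n} then B * (\<Prod>i\<in>S. x i) else 0))"
      by (rule sum.cong[OF refl]) (simp add: c_def)
    also have "\<dots> = A + B * (\<Prod>i\<in>{1..n}. x i)"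
      unfolding sum.distrib by (subst (1 2) sum.delta) simp_all
    finally show "A + B * (\<Prod>i\<in>{1..n}. x i) = (\<Sum>S\<in>Pow {1..n}. c S * (\<Prod>i\<in>S. x i))" ..
  qed
  then have "wt n (\<lambda>x. A + B * (\<Prod>i\<in>{1..n}. x i)) = (\<Sum>S\<in>Pow {1..n}. \<bar>c S\<bar>)"
    unfolding wt_def by (intro sum.cong refl) simp
  also have "\<dots> \<le> (\<Sum>S\<in>Pow {1..n}. (if S = {} then \<bar>A\<bar> else 0) + (if S = {1..n} then \<bar>B\<bar> else 0))"
    unfolding c_def by (rule sum_mono) (use abs_triangle_ineq in auto)
  also have "\<dots> = \<bar>A\<bar> + \<bar>B\<bar>"
    unfolding sum.distrib by (subst (1 2) sum.delta) simp_all
  finally show ?thesis .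
qed

text \<open>With \<open>x = r / n\<close>, an index \<open>i < r\<close> satisfies \<open>x ^ r \<le> x ^ i\<close>, so both tails are bounded
  by the binomial theorem.\<close>

lemma binomial_tails_le:
  assumes r: "0 < r" "r \<le> n"
  shows "(\<Sum>i\<le>n. real (n choose i) * (if i < r \<or> n - r < i then 1 else 0)) \<le>
    2 * (3 * real n / real r) ^ r"
proof -
  define x where "x = real r / real n"
  have x: "0 < x" "x \<le> 1" using r unfolding x_def by auto
  have "(\<Sum>i\<le>n. real (n choose i) * (if i < r \<or> n - r < i then 1 else 0)) * x ^ r \<le>
      (\<Sum>i\<le>n. real (n choose i) * (x ^ i + x ^ (n - i)))"
    unfolding sum_distrib_right
  proof (rule sum_mono)
    fix i assume i: "i \<in> {..n}"
    have "(if i < r \<or> n - r < i then 1 else 0) * x ^ r \<le> x ^ i + x ^ (n - i)"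
    proof -
      have pos: "0 \<le> x ^ i" "0 \<le> x ^ (n - i)" using x by simp_all
      consider "i < r" | "n - r < i" | "\<not> (i < r \<or> n - r < i)" by blast
      then show ?thesis
      proof cases
        case 1
        then have "x ^ r \<le> x ^ i" using x by (intro power_decreasing) auto
        then show ?thesis using 1 pos by simp
      next
        case 2
        then have "n - i \<le> r" using r i by simp
        then have "x ^ r \<le> x ^ (n - i)" using x by (intro power_decreasing) auto
        then show ?thesis using 2 pos by simp
      next
        case 3
        then show ?thesis using pos by simp
      qed
    qed
    then show "real (n choose i) * (if i < r \<or> n - r < i then 1 else 0) * x ^ r
        \<le> real (n choose i) * (x ^ i + x ^ (n - i))"
      unfolding mult.assoc by (rule mult_left_mono) simp
  qed
  also have "\<dots> = (\<Sum>i\<le>n. real (n choose i) * x ^ i * 1 ^ (n - i)) +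
      (\<Sum>i\<le>n. real (n choose i) * 1 ^ i * x ^ (n - i))"
    by (simp add: distrib_left sum.distrib)
  also have "\<dots> = 2 * (1 + x) ^ n"
    using binomial_ring[of x 1 n] binomial_ring[of 1 x n] by (simp add: add.commute)
  also have "\<dots> \<le> 2 * 3 ^ r"
  proof -
    \<comment> \<open>Since \<open>n * x = r\<close>, this is at most e^r, hence at most
      3^r.\<close>
    have "(1 + x) ^ n \<le> exp x ^ n" using x exp_ge_add_one_self[of x] by (intro power_mono) auto
    also have "\<dots> = exp (real n * x)" by (rule exp_of_nat_mult[symmetric])
    also have "real n * x = real r * 1" using r unfolding x_def by simp
    also have "exp \<dots> = exp 1 ^ r" by (rule exp_of_nat_mult)
    also have "\<dots> \<le> 3 ^ r" using exp_le by (intro power_mono) auto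
    finally show ?thesis by simp
  qed
  finally have "(\<Sum>i\<le>n. real (n choose i) * (if i < r \<or> n - r < i then 1 else 0)) \<le>
      2 * 3 ^ r / x ^ r"
    using x by (simp add: pos_le_divide_eq)
  also have "\<dots> = 2 * (3 * real n / real r) ^ r"
    unfolding x_def by (simp add: power_divide power_mult_distrib)
  finally show ?thesis .
qed

section \<open>What the value of r says about the predicate\<close>

lemma symmetric_predicate_values:
  assumes "boolean_function n F" "symmetric_function n F" "i \<le> n"
  shows "sym_predicate n F i \<in> {-1, 1}"
proof -
  have "neg_count n (point n {1..i}) = i" using assms(3) by (simp add: neg_count_point)
  then have "sym_predicate n F i = F (point n {1..i})"
    using sym_predicate_neg_count[OF assms(2) point_in_cube, of "{1..i}"] by simp
  then show ?thesis using assms(1) point_in_cube unfolding boolean_function_def by metis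
qed

lemma r_value_pair:
  obtains r0 r1 where "minimal_pair n (sym_predicate n F) r0 r1" "r_value n F = max r0 r1"
  using minimal_pair_exists r_value_eq by blast

text \<open>Between \<open>r\<close> and \<open>n - r\<close> the predicate has period 2, so it is
  determined there by parity.\<close>

lemma sym_predicate_alternates:
  assumes F: "boolean_function n F" "symmetric_function n F"
  obtains E O' where "E \<in> {-1, 1}" "O' \<in> {-1, 1}"
    and "\<And>i. r_value n F \<le> i \<Longrightarrow> i + r_value n F \<le> n \<Longrightarrow>
      sym_predicate n F i = (if even i then E else O')"
proof -
  let ?D = "sym_predicate n F"
  define r where "r = r_value n F"
  obtain r0 r1 where "minimal_pair n ?D r0 r1" and rm: "r = max r0 r1"
    unfolding r_def using r_value_pair by blast
  then have adm: "admissible_pair n ?D r0 r1" unfolding minimal_pair_def by blast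
  have step: "?D i = ?D (i + 2)" if "r \<le> i" "i + r < n" "i + 2 \<le> n" for i
    using adm that rm unfolding admissible_pair_def by simp
  \<comment> \<open>The default 1 covers the start \<open>r + 1\<close>, which may exceed
    \<open>n\<close>.\<close>
  define v where "v i = (if i \<le> n then ?D i else 1)" for i
  have v: "v i \<in> {-1, 1}" for i using symmetric_predicate_values[OF F] unfolding v_def by simp
  have run: "?D (s + 2 * j) = v s" if "r \<le> s" "s + 2 * j + r \<le> n" for s j
    using that
  proof (induction j)
    case (Suc j)
    then show ?case using step[of "s + 2 * j"] by simp
  qed (simp add: v_def)
  show thesis
  proof (rule that)
    show "(if even r then v r else v (r + 1)) \<in> {-1, 1}"
      "(if even r then v (r + 1) else v r) \<in> {-1, 1}" using v by auto
    fix i assume i: "r_value n F \<le> i" "i + r_value n F \<le> n"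
    then have i': "r \<le> i" "i + r \<le> n" unfolding r_def by auto
    show "?D i = (if even i then (if even r then v r else v (r + 1))
        else (if even r then v (r + 1) else v r))"
    proof (cases "even (i - r)")
      case True
      then obtain j where "i - r = 2 * j" by blast
      then have "i = r + 2 * j" using i'(1) by simp
      then show ?thesis using run[of r j] i' by simp
    next
      case False
      then obtain j where "i - r = 2 * j + 1" by (blast elim: oddE)
      then have "i = (r + 1) + 2 * j" using i'(1) by simp
      then show ?thesis using run[of "r + 1" j] i' by simp
    qed
  qed
qed

text \<open>By minimality, lowering the larger of \<open>r0\<close> and \<open>r1\<close> by one
  breaks admissibility, and only at the single index that this adds. As r is at most about n/2, the
  jump lies at least r/2 from both ends. The last bound keeps n/r at least 3/2, so its logarithm
  stays away from 0.\<close>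

lemma r_value_jump:
  assumes "0 < r_value n F"
  obtains k where "k + 2 \<le> n" "sym_predicate n F k \<noteq> sym_predicate n F (k + 2)"
    "r_value n F \<le> 2 * (k + 1)" "r_value n F \<le> 2 * (n - k - 1)" "3 * r_value n F \<le> 2 * n"
proof -
  let ?D = "sym_predicate n F"
  obtain r0 r1 where m: "minimal_pair n ?D r0 r1" and r: "r_value n F = max r0 r1"
    using r_value_pair by blast
  have adm: "admissible_pair n ?D r0 r1" using m unfolding minimal_pair_def by blast
  have half: "2 * r0 \<le> n + 1" "2 * r1 \<le> n + 1"
    using adm unfolding admissible_pair_def ceiling_half by auto
  show thesis
  proof (cases "r1 \<le> r0")
    case True
    then have r0: "r_value n F = r0" "0 < r0" using r assms by auto
    have "\<not> admissible_pair n ?D (r0 - 1) r1"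
      using m r0(2) unfolding minimal_pair_def
      by (metis diff_le_self le_refl diff_less less_not_refl zero_less_one)
    then obtain i where i: "r0 - 1 \<le> i" "i + r1 < n" "i + 2 \<le> n" "?D i \<noteq> ?D (i + 2)"
      using adm unfolding admissible_pair_def by fastforce
    moreover have "\<not> r0 \<le> i" using adm i unfolding admissible_pair_def by blast
    ultimately have "i = r0 - 1" by linarith
    then show thesis using that[of i] i half r0 by simp
  next
    case False
    then have r1: "r_value n F = r1" "0 < r1" using r by auto
    have "\<not> admissible_pair n ?D r0 (r1 - 1)"
      using m r1(2) unfolding minimal_pair_def
      by (metis diff_le_self le_refl diff_less less_not_refl zero_less_one)
    then obtain i where i: "r0 \<le> i" "i + (r1 - 1) < n" "i + 2 \<le> n" "?D i \<noteq> ?D (i + 2)"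
      using adm unfolding admissible_pair_def by fastforce
    moreover have "\<not> i + r1 < n" using adm i unfolding admissible_pair_def by blast
    ultimately have "i + r1 = n" by linarith
    then show thesis using that[of i] i half r1 by simp
  qed
qed

lemma wt_upper:
  assumes F: "boolean_function n F" "symmetric_function n F"
  shows "wt n F \<le> 1 + 2 * (\<Sum>i\<le>n. real (n choose i) *
    (if i < r_value n F \<or> n - r_value n F < i then 1 else 0))"
proof -
  let ?D = "sym_predicate n F"
  define r where "r = r_value n F"
  obtain E O' where EO: "E \<in> {-1, 1}" "O' \<in> {-1, 1}"
    and D: "\<And>i. r \<le> i \<Longrightarrow> i + r \<le> n \<Longrightarrow> ?D i = (if even i then E else O')"
    unfolding r_def using sym_predicate_alternates[OF F] by metis
  \<comment> \<open>\<open>A + B = E\<close> and \<open>A - B = O'\<close> match even and odd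
    parity; one of \<open>A\<close>, \<open>B\<close> is 0 and the other 1 or -1.\<close>
  define A B where "A = (E + O') / 2" and "B = (E - O') / 2"
  let ?G = "\<lambda>x. A + B * (\<Prod>i\<in>{1..n}. x i)"
  let ?f = "\<lambda>i. 2 * (if i < r \<or> n - r < i then 1 else (0::real))"
  have AB: "\<bar>A\<bar> + \<bar>B\<bar> \<le> 1" using EO unfolding A_def B_def by auto
  have "(\<Sum>x\<in>cube n. \<bar>F x - ?G x\<bar>) = (\<Sum>U\<in>Pow {1..n}. \<bar>F (point n U) - ?G (point n U)\<bar>)"
    using sum.reindex_bij_betw[OF bij_betw_point, of "\<lambda>x. \<bar>F x - ?G x\<bar>" n] by simp
  also have "\<dots> \<le> (\<Sum>U\<in>Pow {1..n}. ?f (card U))"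
  proof (rule sum_mono)
    fix U assume "U \<in> Pow {1..n}"
    then have U: "U \<subseteq> {1..n}" by simp
    then have cU: "card U \<le> n" using card_mono[of "{1..n}" U] by simp
    have FD: "F (point n U) = ?D (card U)"
      using sym_predicate_neg_count[OF F(2) point_in_cube, of U] neg_count_point[OF U] by simp
    have G: "?G (point n U) = (if even (card U) then E else O')"
    proof -
      have "{1..n} \<inter> U = U" using U by blast
      then have "?G (point n U) = A + B * (-1) ^ card U" by (simp only: prod_point[OF order_refl])
      also have "\<dots> = (if even (card U) then E else O')"
        by (simp add: A_def B_def minus_one_power_iff field_simps)
      finally show ?thesis .
    qed
    have DV: "?D (card U) \<in> {-1, 1}" using symmetric_predicate_values[OF F cU] .
    show "\<bar>F (point n U) - ?G (point n U)\<bar> \<le> ?f (card U)"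
    proof (cases "card U < r \<or> n - r < card U")
      case True
      have "\<bar>?D (card U) - (if even (card U) then E else O')\<bar> \<le> 2" using DV EO by auto
      then show ?thesis unfolding FD G using True by simp
    next
      case False
      then have "r \<le> card U" "card U + r \<le> n" using cU by auto
      then show ?thesis unfolding FD G using D by simp
    qed
  qed
  also have "\<dots> = (\<Sum>i\<le>n. real (n choose i) * ?f i)"
    using sum_Pow_card[of "{1..n}" ?f] by simp
  also have "\<dots> = 2 * (\<Sum>i\<le>n. real (n choose i) * (if i < r \<or> n - r < i then 1 else 0))"
    unfolding sum_distrib_left by (rule sum.cong) auto
  finally show ?thesis
    using wt_le_wt_plus_l1[of n F ?G] wt_affine_parity_le[of n A B] AB unfolding r_def by linarith
qed

lemma wt_upper_power:
  assumes F: "boolean_function n F" "symmetric_function n F" and r: "0 < r_value n F"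
  shows "wt n F \<le> (real n / real (r_value n F)) ^ (8 * r_value n F)"
proof -
  define r where "r = r_value n F"
  obtain k where "3 * r \<le> 2 * n" unfolding r_def using r_value_jump[OF r] by blast
  then have le: "0 < r" "r \<le> n" "3 / 2 \<le> real n / real r"
    using r unfolding r_def[symmetric] by (auto simp: field_simps)
  define y where "y = real n / real r"
  have y: "3 / 2 \<le> y" using le unfolding y_def by simp
  have "wt n F \<le> 1 + 4 * (3 * y) ^ r"
    using wt_upper[OF F] binomial_tails_le[OF le(1,2)] unfolding r_def[symmetric] y_def by simp
  also have "\<dots> \<le> 5 * (3 * y) ^ r"
  proof -
    have "1 \<le> (3 * y) ^ r" using y by (intro one_le_power) simp
    then show ?thesis by linarith
  qed
  also have "\<dots> \<le> 5 ^ r * (3 * y) ^ r"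
    using power_increasing[of 1 r "5::real"] le(1) y by (intro mult_right_mono) auto
  also have "\<dots> = (15 * y) ^ r"
  proof -
    have "5 ^ r * (3 * y) ^ r = (5 * (3 * y)) ^ r" by (rule power_mult_distrib[symmetric])
    also have "5 * (3 * y) = 15 * y" by simp
    finally show ?thesis .
  qed
  also have "\<dots> \<le> (y ^ 8) ^ r"
  proof (rule power_mono)
    \<comment> \<open>The exponent 8 arises here: seven factors \<open>y\<close>, each at least 3/2,
      absorb the constant 15.\<close>
    have "15 \<le> (3 / 2 :: real) ^ 7" by (simp add: power_divide)
    also have "\<dots> \<le> y ^ 7" using y by (intro power_mono) auto
    finally have "15 * y \<le> y ^ 7 * y" using y by (intro mult_right_mono) auto
    also have "\<dots> = y ^ 8" by (simp add: eval_nat_numeral)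
    finally show "15 * y \<le> y ^ 8" .
  qed (use y in simp)
  finally show ?thesis unfolding y_def r_def by (simp add: power_mult)
qed

subsection \<open>The lower bound\<close>

lemma two_powr_quarter_le: "2 powr (1 / 4) \<le> (4 / 3 :: real)"
proof -
  have "2 powr (1 / 4) \<le> ((4 / 3 :: real) powr 4) powr (1 / 4)"
    by (intro powr_mono2) (simp_all add: power_divide)
  also have "\<dots> = 4 / 3" by (simp only: powr_powr) simp
  finally show ?thesis .
qed

text \<open>A jump far from both ends gives exponential weight; if it is close to an end, r is
  bounded and the constant 4/3 from two bits suffices.\<close>

lemma wt_lower:
  assumes F: "boolean_function n F" "symmetric_function n F" and r: "0 < r_value n F"
    and p: "\<And>x. x \<in> cube n \<Longrightarrow> \<bar>p x - F x\<bar> < 1 / 3"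
  shows "2 powr (real (r_value n F) / 500) \<le> wt n p"
proof -
  let ?D = "sym_predicate n F"
  define r where "r = r_value n F"
  obtain k where k: "k + 2 \<le> n" "?D k \<noteq> ?D (k + 2)" "r \<le> 2 * (k + 1)" "r \<le> 2 * (n - k - 1)"
    unfolding r_def using r_value_jump[OF r] by blast
  define m where "m = min (k + 1) (n - k - 1)"
  have m: "m \<le> k + 1" "m + k + 1 \<le> n" "r \<le> 2 * m"
    unfolding m_def using k by arith+
  have pD: "\<bar>p x - ?D (neg_count n x)\<bar> < 1 / 3" if "x \<in> cube n" for x
    using p[OF that] sym_predicate_neg_count[OF F(2) that] by simp
  have D: "?D i \<in> {-1, 1}" if "i \<le> n" for i using symmetric_predicate_values[OF F that] .
  show ?thesis
  \<comment> \<open>Below 58, \<open>r \<le> 114\<close> keeps \<open>r / 500\<close> under 1/4.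
    From 58 on, \<open>L \<ge> 2\<close>, so that \<open>4 ^ L / 4\<close> dominates although r may
    be as large as \<open>56 * L + 58\<close>.\<close>
  proof (cases "m < 58")
    case True
    then have "real r / 500 \<le> 1 / 4" using m(3) by linarith
    then have "2 powr (real r / 500) \<le> 2 powr (1 / 4)" by (intro powr_mono) auto
    also have "\<dots> \<le> 4 / 3" by (rule two_powr_quarter_le)
    also have "\<dots> \<le> wt n p" by (rule wt_ge_two_bits[where D = ?D, OF pD D k(1,2)])
    finally show ?thesis unfolding r_def .
  next
    case False
    define L where "L = (m - 2) div 28"
    have L: "2 \<le> L" "28 * L + 2 \<le> m" "m \<le> 28 * L + 29" using False unfolding L_def by auto
    have "real r / 500 \<le> 2 * real L - 2" using m(3) L by linarith
    then have "2 powr (real r / 500) \<le> 2 powr (2 * real L - 2)" by (intro powr_mono) auto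
    also have "\<dots> = 4 ^ L / 4"
    proof -
      have "2 powr (2 * real L - 2) = 2 powr (real (2 * L)) / 2 powr 2"
        by (simp add: powr_diff)
      also have "\<dots> = 2 ^ (2 * L) / 4" by (subst powr_realpow) auto
      finally show ?thesis by (simp add: power_mult)
    qed
    also have "\<dots> \<le> wt n p"
      by (rule wt_ge_exponential[where D = ?D, OF pD D k(2) _ L(2) m(1,2)]) (use L in auto)
    finally show ?thesis unfolding r_def .
  qed
qed

section \<open>Passing to the infimum and to logarithms\<close>

lemma wt_approx_ge:
  assumes "0 < e" and "\<And>p. (\<And>x. x \<in> cube n \<Longrightarrow> \<bar>p x - F x\<bar> < e) \<Longrightarrow> c \<le> wt n p"
  shows "c \<le> wt_approx n e F"
  unfolding wt_approx_def
proof (rule cInf_greatest)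
  show "{wt n p |p. \<forall>x\<in>cube n. \<bar>p x - F x\<bar> < e} \<noteq> {}"
    using assms(1) by (auto intro!: exI[of _ F])
qed (use assms(2) in blast)

lemma wt_approx_le:
  assumes "0 < e"
  shows "wt_approx n e F \<le> wt n F"
  unfolding wt_approx_def
proof (rule cInf_lower)
  show "wt n F \<in> {wt n p |p. \<forall>x\<in>cube n. \<bar>p x - F x\<bar> < e}" using assms by auto
  show "bdd_below {wt n p |p. \<forall>x\<in>cube n. \<bar>p x - F x\<bar> < e}"
    by (rule bdd_belowI[of _ 0]) (auto simp: wt_nonneg)
qed

text \<open>Positivity makes the logarithm monotone here. At any point an approximant exceeds 2/3 in
  absolute value, and its weight bounds its values.\<close>

lemma wt_approx_boolean_pos:
  assumes "boolean_function n F"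
  shows "0 < wt_approx n (1 / 3) F"
proof -
  have "2 / 3 \<le> wt_approx n (1 / 3) F"
  proof (rule wt_approx_ge)
    fix p assume p: "\<And>x. x \<in> cube n \<Longrightarrow> \<bar>p x - F x\<bar> < 1 / 3"
    let ?x = "point n {}"
    have "F ?x \<in> {-1, 1}" using assms point_in_cube unfolding boolean_function_def by blast
    then have "F ?x = -1 \<or> F ?x = 1" by simp
    then show "2 / 3 \<le> wt n p"
      using p[OF point_in_cube, of "{}"] abs_le_wt[OF point_in_cube[of n "{}"], of p]
      by (elim disjE) linarith+
  qed simp
  then show ?thesis by linarith
qed

text \<open>The lower bound asks for r > 0: the constant 1 has r = 0 but is approximated by
  constants just above 2/3, so the logarithm of its approximate weight is negative.\<close>

theorem mainTheorem2:
  shows "\<exists>c0 c1 :: real. c0 > 0 \<and> c1 > 0 \<and>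
    (\<forall>(n :: nat) (F :: (nat \<Rightarrow> real) \<Rightarrow> real).
       boolean_function n F \<and> symmetric_function n F \<longrightarrow>
         c0 * real (r_value n F) * log 2 (real n / real (r_value n F)) \<ge> log 2 (wt n F) \<and>
         log 2 (wt n F) \<ge> log 2 (wt_approx n (1 / 3) F) \<and>
         (r_value n F > 0 \<longrightarrow> log 2 (wt_approx n (1 / 3) F) \<ge> c1 * real (r_value n F)))"
proof (intro exI conjI allI impI; (elim conjE)?)
  show "(8::real) > 0" "(1 / 500 :: real) > 0" by simp_all
  fix n :: nat and F :: "(nat \<Rightarrow> real) \<Rightarrow> real"
  assume F: "boolean_function n F" "symmetric_function n F"
  define r where "r = r_value n F"
  have pos: "0 < wt_approx n (1 / 3) F" using F(1) by (rule wt_approx_boolean_pos)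
  have le: "wt_approx n (1 / 3) F \<le> wt n F" by (rule wt_approx_le) simp
  show "log 2 (wt n F) \<ge> log 2 (wt_approx n (1 / 3) F)" using pos le by simp
  show "8 * real (r_value n F) * log 2 (real n / real (r_value n F)) \<ge> log 2 (wt n F)"
  proof (cases "r = 0")
    \<comment> \<open>There are no exceptional points, so the weight is at most 1, and the left side
      is 0 because of the factor r.\<close>
    case True
    then have "wt n F \<le> 1" using wt_upper[OF F] unfolding r_def by simp
    then show ?thesis using True pos le unfolding r_def by simp
  next
    case False
    then have "wt n F \<le> (real n / real r) ^ (8 * r)"
      using wt_upper_power[OF F] unfolding r_def by simp
    then have "log 2 (wt n F) \<le> log 2 ((real n / real r) ^ (8 * r))"
      using pos le by (intro log_mono) auto
    also have "\<dots> = real (8 * r) * log 2 (real n / real r)"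
    proof -
      obtain k where "k + 2 \<le> n" using r_value_jump[of n F] False unfolding r_def by blast
      then have "0 < n" by simp
      then show ?thesis using False by (intro log_nat_power) simp
    qed
    finally show ?thesis unfolding r_def by simp
  qed
  assume r: "r_value n F > 0"
  have "2 powr (real (r_value n F) / 500) \<le> wt_approx n (1 / 3) F"
    by (rule wt_approx_ge) (use wt_lower[OF F r] in auto)
  then have "real (r_value n F) / 500 \<le> log 2 (wt_approx n (1 / 3) F)"
    by (intro iffD2[OF le_log_iff] pos) simp
  then show "log 2 (wt_approx n (1 / 3) F) \<ge> 1 / 500 * real (r_value n F)" by simp
qed

end
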